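(* Let $N_\beta(\alpha)=\#\{(k,m)\in\mathbb{Z}_{>0}^2 : m\le \alpha\sqrt{\beta}-k\beta\}$ for $\alpha,\beta>0$, let $$\Lambda=\Big\{\beta\in\mathbb{Q}_{>0} : \limsup_{\alpha\to\infty}\frac{N_\beta(\alpha)-\alpha^2/2}{\alpha}>-1\Big\},$$ and let $$S=\bigcap_{r>0}\ \bigcup_{\alpha>r}\ \operatorname*{argmax}_{\beta>0} N_\beta(\alpha),$$ i.e. $S$ is the set of slopes $\beta>0$ such that for arbitrarily large $\alpha$, $N_\beta(\alpha)=\sup_{\beta'>0}N_{\beta'}(\alpha)$. Then $\Lambda\cap S$ is an infinite set.
   Context: $N_\beta(\alpha)$ counts lattice points with positive integer coordinates in the closed triangle with vertices $(0,0)$, $(\alpha/\sqrt\beta,0)$, $(0,\alpha\sqrt\beta)$, which has area $\alpha^2/2$. *)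

theory Defs
  imports "HOL-Analysis.Analysis"
begin

definition lattice_count :: "real \<Rightarrow> real \<Rightarrow> nat" where
  "lattice_count \<beta> \<alpha> =
     card {(k::int, m::int). k > 0 \<and> m > 0 \<and>
            real_of_int m \<le> \<alpha> * sqrt \<beta> - real_of_int k * \<beta>}"

text \<open>The upper limit is taken in the extended reals, so that no boundedness has to be assumed.\<close>

definition Lambda_set :: "real set" where
  "Lambda_set = {\<beta> \<in> \<rat>. \<beta> > 0 \<and>
     Limsup at_top (\<lambda>\<alpha>::real. ereal ((real (lattice_count \<beta> \<alpha>) - \<alpha>\<^sup>2 / 2) / \<alpha>)) > -1}"

definition optimal_slopes :: "real \<Rightarrow> real set" where
  "optimal_slopes \<alpha> = {\<beta>. is_arg_max (\<lambda>b. lattice_count b \<alpha>) (\<lambda>b. b > 0) \<beta>}"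

definition S_set :: "real set" where
  "S_set = (\<Inter>r\<in>{0<..}. \<Union>\<alpha>\<in>{r<..}. optimal_slopes \<alpha>)"

end

theory Submission
  imports Defs
begin

text \<open>
  For \<open>\<beta> = p/q\<close> in lowest terms and \<open>s = \<surd>(pq)\<close>, the count is \<open>\<alpha>\<^sup>2/2 - \<alpha> (p + q - 1 + 2x) / (2s) + O(1)\<close>, where
  \<open>x\<close> is the fractional part of \<open>\<alpha>s\<close>. Given \<open>n\<close>, let \<open>M = \<surd>(n(n+1))\<close>. Simultaneous approximation
  yields arbitrarily large \<open>T\<close> with all the relevant \<open>Ts\<close> close to integers; for \<open>\<alpha>\<close> slightly above \<open>T - 1/M\<close>
  the slope \<open>(n+1)/n\<close> is at its best (\<open>x\<close> near 0), whereas slopes with \<open>s < M/2\<close> have \<open>x\<close> near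
  \<open>1 - s/M\<close>, so those with \<open>s \<le> M/4\<close> are worse than \<open>\<alpha>\<^sup>2/2 - \<alpha> + O(1)\<close>, which \<open>(n+1)/n\<close> beats by a multiple of \<open>\<alpha>\<close>.

  A slope \<open>\<beta>\<close> that is not close to a rational with small denominator has equidistributed fractional parts
  and loses too. A slope close to \<open>p/q\<close> either encloses no lattice line that \<open>p/q\<close> misses, and then \<open>p/q\<close> is at
  least as good, or it is tilted so much that the average of the fractional parts is controlled by
  \<open>x(1 - x)\<close>, which is again too small for \<open>\<beta>\<close> to beat \<open>(n+1)/n\<close>. Hence for these \<open>\<alpha>\<close> the maximum is attained in a
  finite set of rationals depending on \<open>n\<close> only; one of them is optimal for arbitrarily large \<open>\<alpha>\<close>, lies in \<open>\<Lambda>\<close>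
  because it does at least as well as \<open>(n+1)/n\<close>, and has \<open>s > M/4\<close>. Letting \<open>n\<close> grow gives
  infinitely many slopes.
\<close>

section \<open>Counting by columns\<close>

lemma lattice_triangle_eq:
  fixes \<alpha> \<beta> :: real
  assumes "\<alpha> > 0" "\<beta> > 0" and a: "a = \<alpha> / sqrt \<beta>"
  shows "{(k::int, m::int). k > 0 \<and> m > 0 \<and> real_of_int m \<le> \<alpha> * sqrt \<beta> - real_of_int k * \<beta>} =
    (SIGMA k:{1..\<lfloor>a\<rfloor>}. {1..\<lfloor>(a - real_of_int k) * \<beta>\<rfloor>})"
proof -
  have ab: "\<alpha> * sqrt \<beta> = a * \<beta>"
    using assms by (simp add: a real_div_sqrt field_simps)
  have iff: "k > 0 \<and> m > 0 \<and> real_of_int m \<le> \<alpha> * sqrt \<beta> - real_of_int k * \<beta> \<longleftrightarrow>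
      k \<in> {1..\<lfloor>a\<rfloor>} \<and> m \<in> {1..\<lfloor>(a - real_of_int k) * \<beta>\<rfloor>}" (is "?L \<longleftrightarrow> ?R") for k m :: int
  proof
    assume km: ?L
    then have m: "real_of_int m \<le> (a - real_of_int k) * \<beta>"
      by (simp add: ab algebra_simps)
    moreover have "0 < real_of_int m" using km by simp
    ultimately have "0 < (a - real_of_int k) * \<beta>" by linarith
    then have "real_of_int k < a" using \<open>\<beta> > 0\<close> by (simp add: zero_less_mult_iff)
    with m km show ?R by (simp add: le_floor_iff)
  next
    assume ?R
    then have "real_of_int m \<le> (a - real_of_int k) * \<beta>" by (simp add: le_floor_iff)
    with \<open>?R\<close> show ?L by (simp add: ab algebra_simps)
  qed
  show ?thesis
    unfolding iff by auto
qed

lemma lattice_count_eq_sum: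
  fixes \<alpha> \<beta> :: real
  assumes "\<alpha> > 0" "\<beta> > 0" and a: "a = \<alpha> / sqrt \<beta>"
  shows "real (lattice_count \<beta> \<alpha>) = (\<Sum>k<nat \<lfloor>a\<rfloor>. real_of_int \<lfloor>(a - real (Suc k)) * \<beta>\<rfloor>)"
proof -
  have "real (lattice_count \<beta> \<alpha>) = (\<Sum>k\<in>{1..\<lfloor>a\<rfloor>}. real (nat \<lfloor>(a - real_of_int k) * \<beta>\<rfloor>))"
    by (simp add: lattice_count_def lattice_triangle_eq[OF assms])
  also have "\<dots> = (\<Sum>k\<in>{1..\<lfloor>a\<rfloor>}. real_of_int \<lfloor>(a - real_of_int k) * \<beta>\<rfloor>)"
  proof (rule sum.cong)
    fix k assume "k \<in> {1..\<lfloor>a\<rfloor>}"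
    then have "real_of_int k \<le> a" by (simp add: le_floor_iff)
    then have "0 \<le> (a - real_of_int k) * \<beta>" using \<open>\<beta> > 0\<close> by simp
    then show "real (nat \<lfloor>(a - real_of_int k) * \<beta>\<rfloor>) = real_of_int \<lfloor>(a - real_of_int k) * \<beta>\<rfloor>"
      by simp
  qed simp
  also have "\<dots> = (\<Sum>k<nat \<lfloor>a\<rfloor>. real_of_int \<lfloor>(a - real (Suc k)) * \<beta>\<rfloor>)"
  proof -
    have "bij_betw (\<lambda>k. int (Suc k)) {..<nat \<lfloor>a\<rfloor>} {1..\<lfloor>a\<rfloor>}"
      by (rule bij_betw_byWitness[where f' = "\<lambda>k. nat (k - 1)"]) (auto, linarith)
    from sum.reindex_bij_betw[OF this, of "\<lambda>k. real_of_int \<lfloor>(a - real_of_int k) * \<beta>\<rfloor>"] show ?thesis by simp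
  qed
  finally show ?thesis .
qed

text \<open>Each floor is split into its argument minus its fractional part. The arguments sum to a
  quadratic in \<open>\<lfloor>a\<rfloor>\<close>, and substituting \<open>a - frac a\<close> for
  this floor leaves the term with \<open>frac a * (1 - frac a)\<close>. Estimating a count thus
  amounts to estimating the sum of fractional parts.\<close>

lemma lattice_count_frac:
  fixes \<alpha> \<beta> :: real
  assumes "\<alpha> > 0" "\<beta> > 0" and a: "a = \<alpha> / sqrt \<beta>"
  shows "real (lattice_count \<beta> \<alpha>) = \<alpha>\<^sup>2 / 2 - a * \<beta> / 2 + \<beta> * (frac a * (1 - frac a)) / 2
           - (\<Sum>k<nat \<lfloor>a\<rfloor>. frac ((a - real (Suc k)) * \<beta>))"
proof -
  have "a > 0" using assms by simp
  have lin: "(\<Sum>k<n. (a - real (Suc k)) * \<beta>) = \<beta> * (a * real n - real n * (real n + 1) / 2)" for n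
    by (induction n) (auto simp: field_simps)
  have K: "real (nat \<lfloor>a\<rfloor>) = a - frac a"
    using \<open>a > 0\<close> by (simp add: frac_def)
  have al: "\<alpha>\<^sup>2 = a\<^sup>2 * \<beta>"
    using assms by (simp add: a power_divide)
  have "real (lattice_count \<beta> \<alpha>) = (\<Sum>k<nat \<lfloor>a\<rfloor>. (a - real (Suc k)) * \<beta>)
           - (\<Sum>k<nat \<lfloor>a\<rfloor>. frac ((a - real (Suc k)) * \<beta>))"
    unfolding lattice_count_eq_sum[OF assms] sum_subtractf[symmetric]
    by (rule sum.cong) (simp_all add: frac_def)
  moreover have "\<beta> * (a * (a - frac a) - (a - frac a) * (a - frac a + 1) / 2) =
       \<alpha>\<^sup>2 / 2 - a * \<beta> / 2 + \<beta> * (frac a * (1 - frac a)) / 2"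
    unfolding al by (simp add: field_simps power2_eq_square)
  ultimately show ?thesis unfolding lin K by simp
qed

text \<open>Swapping the coordinates reflects one triangle onto the other; very flat slopes thereby
  reduce to very steep ones.\<close>

lemma lattice_count_inverse:
  fixes \<alpha> \<beta> :: real
  assumes "\<beta> > 0"
  shows "lattice_count (1 / \<beta>) \<alpha> = lattice_count \<beta> \<alpha>"
proof -
  have s: "sqrt \<beta> * sqrt \<beta> = \<beta>" "sqrt \<beta> > 0" using assms by auto
  have iff: "real_of_int m \<le> \<alpha> * sqrt (1 / \<beta>) - real_of_int k * (1 / \<beta>) \<longleftrightarrow>
        real_of_int k \<le> \<alpha> * sqrt \<beta> - real_of_int m * \<beta>" for k m :: int
  proof -
    have "\<alpha> * sqrt (1 / \<beta>) - real_of_int k * (1 / \<beta>) = (\<alpha> * sqrt \<beta> - real_of_int k) / \<beta>"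
      using assms s by (simp add: real_sqrt_divide field_simps)
    then show ?thesis using assms by (simp add: le_divide_eq algebra_simps)
  qed
  show ?thesis
    unfolding lattice_count_def iff
    by (rule bij_betw_same_card[where f = prod.swap], rule bij_betw_byWitness[where f' = prod.swap]) auto
qed

section \<open>Fractional parts over complete residue systems\<close>

lemma sum_mod_progression:
  fixes p q m :: nat and z :: int
  assumes "coprime p q" "q > 0"
  shows "2 * (\<Sum>i\<in>{m..<m+q}. (z - int i * int p) mod int q) = int q * (int q - 1)"
proof -
  let ?f = "\<lambda>i. (z - int i * int p) mod int q"
  have inj: "inj_on ?f {m..<m+q}"
  proof (rule inj_onI)
    fix i j assume ij: "i \<in> {m..<m+q}" "j \<in> {m..<m+q}" and "?f i = ?f j"
    then have "int q dvd (z - int i * int p) - (z - int j * int p)"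
      by (simp add: mod_eq_dvd_iff)
    then have "int q dvd (int j - int i) * int p"
      by (simp add: algebra_simps)
    then have "int q dvd int j - int i"
      using assms(1) by (simp add: coprime_commute coprime_dvd_mult_left_iff)
    moreover have "\<bar>int j - int i\<bar> < int q" using ij by auto
    ultimately show "i = j"
      using zdvd_not_zless[of "\<bar>int j - int i\<bar>" "int q"] by (cases "j = i") auto
  qed
  have sub: "?f ` {m..<m+q} \<subseteq> {0..<int q}" using assms(2) by auto
  have "bij_betw ?f {m..<m+q} {0..<int q}"
    unfolding bij_betw_def using inj card_subset_eq[OF _ sub] by (simp add: card_image)
  then have "(\<Sum>i\<in>{m..<m+q}. ?f i) = \<Sum>{0..<int q}"
    by (rule sum.reindex_bij_betw[where g = "\<lambda>x. x", simplified])
  also have "\<dots> = (\<Sum>i<q. int i)"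
    by (rule sum.reindex_bij_witness[where i = int and j = nat]) auto
  finally have "(\<Sum>i\<in>{m..<m+q}. ?f i) = (\<Sum>i<q. int i)" .
  moreover have "2 * (\<Sum>i<n. int i) = int n * (int n - 1)" for n
    by (induction n) (auto simp: algebra_simps)
  ultimately show ?thesis by simp
qed

text \<open>All numerators share the fractional part \<open>frac U\<close>, and their integer parts
  meet every residue modulo \<open>q\<close> once because \<open>p\<close> is invertible. The
  summands are therefore \<open>(frac U + r) / q\<close> for \<open>r = 0, ..., q - 1\<close> in
  some order.\<close>

lemma sum_frac_block:
  fixes p q m :: nat and U :: real
  assumes "coprime p q" "q > 0"
  shows "(\<Sum>i\<in>{m..<m+q}. frac ((U - real i * real p) / real q)) = frac U + (real q - 1) / 2"
proof -
  have f: "frac ((U - real i * real p) / real q) =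
      (frac U + real_of_int ((\<lfloor>U\<rfloor> - int i * int p) mod int q)) / real q" for i
  proof -
    let ?z = "\<lfloor>U\<rfloor> - int i * int p"
    have "(U - real i * real p) / real q =
        (frac U + real_of_int (?z mod int q)) / real q + real_of_int (?z div int q)"
    proof -
      have "real_of_int ?z = real_of_int (?z div int q) * real q + real_of_int (?z mod int q)"
        by (metis div_mult_mod_eq of_int_add of_int_mult of_int_of_nat_eq)
      then show ?thesis using assms(2) by (simp add: frac_def field_simps)
    qed
    moreover have "real_of_int (?z mod int q) \<ge> 0" "real_of_int (?z mod int q) \<le> real q - 1"
    proof -
      have "?z mod int q \<le> int q - 1" using assms(2) by (simp add: pos_mod_bound zle_diff1_eq)
      then show "real_of_int (?z mod int q) \<le> real q - 1" by linarith
    qed (use assms(2) in simp)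
    moreover have "0 \<le> frac U" "frac U < 1" by (auto simp: frac_lt_1)
    ultimately show ?thesis
      using assms(2) by (subst frac_unique_iff) (auto simp: divide_less_eq)
  qed
  have "2 * (\<Sum>i\<in>{m..<m+q}. real_of_int ((\<lfloor>U\<rfloor> - int i * int p) mod int q)) = real q * (real q - 1)"
    using arg_cong[OF sum_mod_progression[OF assms, of "\<lfloor>U\<rfloor>" m], of real_of_int] by simp
  then have "(\<Sum>i\<in>{m..<m+q}. real_of_int ((\<lfloor>U\<rfloor> - int i * int p) mod int q)) = real q * (real q - 1) / 2"
    by simp
  then show ?thesis
    unfolding f sum_divide_distrib[symmetric] sum.distrib
    using assms(2) by (simp add: field_simps)
qed

text \<open>Lowering an argument cannot raise its floor, so a fractional part drops by at most the
  amount of the lowering. This one-sidedness is why \<open>U\<close> has to bound the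
  \<open>u i\<close> from above.\<close>

lemma sum_frac_block_ge:
  fixes p q m :: nat and U e :: real and u :: "nat \<Rightarrow> real"
  assumes "coprime p q" "q > 0"
    and u: "\<And>i. i \<in> {m..<m+q} \<Longrightarrow> u i \<le> U \<and> U - e \<le> u i"
  shows "(\<Sum>i\<in>{m..<m+q}. frac ((u i - real i * real p) / real q)) \<ge> frac U + (real q - 1) / 2 - e"
proof -
  have "frac ((U - real i * real p) / real q) - e / real q \<le> frac ((u i - real i * real p) / real q)"
    if "i \<in> {m..<m+q}" for i
  proof -
    let ?v = "(u i - real i * real p) / real q" and ?w = "(U - real i * real p) / real q"
    have "?v \<le> ?w" using u[OF that] assms(2) by (simp add: divide_right_mono)
    then have "\<lfloor>?v\<rfloor> \<le> \<lfloor>?w\<rfloor>" by (rule floor_mono)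
    moreover have "?w - e / real q \<le> ?v"
      using u[OF that] assms(2) by (simp add: diff_divide_distrib[symmetric] divide_right_mono)
    ultimately show ?thesis by (simp add: frac_def)
  qed
  then have "(\<Sum>i\<in>{m..<m+q}. frac ((U - real i * real p) / real q) - e / real q)
      \<le> (\<Sum>i\<in>{m..<m+q}. frac ((u i - real i * real p) / real q))"
    by (rule sum_mono)
  then show ?thesis
    unfolding sum_subtractf sum_frac_block[OF assms(1,2)] using assms(2) by simp
qed

section \<open>Fractional parts along arithmetic progressions\<close>

text \<open>The periodic antiderivative of \<open>frac u - 1/2\<close>.\<close>

definition parab :: "real \<Rightarrow> real" where
  "parab u = frac u * (frac u - 1) / 2"

text \<open>Even across integers, where \<open>parab\<close> has a kink, it stays below the parabola of the current period,
  because \<open>z (z - 1)\<close> is smallest among integer translates of \<open>z\<close> at the fractional part.\<close>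

lemma parab_le: "parab (u + d) \<le> parab u + d * (frac u - 1/2) + d\<^sup>2 / 2"
proof -
  define j where "j = \<lfloor>u + d\<rfloor> - \<lfloor>u\<rfloor>"
  define z where "z = frac u + d"
  have fz: "frac (u + d) = z - real_of_int j"
    by (simp add: j_def z_def frac_def)
  have j: "j = \<lfloor>z\<rfloor>"
  proof -
    have "0 \<le> z - real_of_int j" "z - real_of_int j < 1"
      using fz frac_ge_0[of "u + d"] frac_lt_1[of "u + d"] by auto
    then show ?thesis by (metis add.commute diff_ge_0_iff_ge floor_unique less_diff_eq diff_less_eq)
  qed
  have "(z - real_of_int j) * (z - real_of_int j - 1) \<le> z * (z - 1)"
  proof -
    have "z * (z - 1) - (z - real_of_int j) * (z - real_of_int j - 1)
        = real_of_int j * (2 * (z - real_of_int j) + (real_of_int j - 1))"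
      by (simp add: algebra_simps)
    moreover have "real_of_int j * (2 * (z - real_of_int j) + (real_of_int j - 1)) \<ge> 0"
    \<comment> \<open>The two factors have the same sign: the second is at least
      \<open>j - 1\<close>, and strictly below \<open>j + 1\<close>.\<close>
    proof (cases "j \<ge> 1")
      case True
      then show ?thesis using fz frac_ge_0[of "u + d"]
        by (intro mult_nonneg_nonneg) auto
    next
      case False
      then consider "j = 0" | "j \<le> -1" by linarith
      then show ?thesis
      proof cases
        case 2
        then show ?thesis using fz frac_lt_1[of "u + d"]
          by (intro mult_nonpos_nonpos) auto
      qed simp
    qed
    ultimately show ?thesis by linarith
  qed
  then show ?thesis
    unfolding parab_def fz z_def[symmetric]
    by (simp add: z_def field_simps power2_eq_square)
qed

lemma parab_bounds: "-1/8 \<le> parab u" "parab u \<le> 0"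
proof -
  have "0 \<le> (frac u - 1/2)\<^sup>2" by simp
  then show "-1/8 \<le> parab u" by (simp add: parab_def power2_eq_square algebra_simps)
  show "parab u \<le> 0"
    by (simp add: parab_def mult_nonneg_nonpos frac_lt_1 less_imp_le)
qed

text \<open>For distance at most 1, \<open>parab_le\<close> gives slope at most 1/2 in absolute
  value plus a quadratic term of at most half the distance; beyond distance 1 the small range of
  \<open>parab\<close> suffices.\<close>

lemma parab_lipschitz: "\<bar>parab u - parab v\<bar> \<le> \<bar>u - v\<bar>"
proof -
  have *: "parab x - parab y \<le> \<bar>x - y\<bar>" for x y
  proof (cases "\<bar>x - y\<bar> \<le> 1")
    case False
    then show ?thesis using parab_bounds[of x] parab_bounds[of y] by linarith
  next
    case True
    define d where "d = x - y"
    have "\<bar>frac y - 1/2\<bar> \<le> 1/2"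
      using frac_ge_0[of y] frac_lt_1[of y] by linarith
    then have "\<bar>d * (frac y - 1/2)\<bar> \<le> \<bar>d\<bar> * (1/2)"
      unfolding abs_mult by (intro mult_left_mono) auto
    moreover have "d\<^sup>2 \<le> \<bar>d\<bar>"
      using True by (metis abs_ge_zero d_def mult_left_le power2_abs power2_eq_square)
    ultimately show ?thesis using parab_le[of y d] by (simp add: d_def)
  qed
  show ?thesis using *[of u v] *[of v u] by linarith
qed

text \<open>Telescoping of \<open>parab_le\<close> with step \<open>H\<close>: the sum is a Riemann
  sum for \<open>frac - 1/2\<close>, at a cost of \<open>H\<^sup>2 / 2\<close> per step.\<close>

lemma sum_frac_progression_ge:
  fixes W H :: real
  shows "H * (\<Sum>j<n. frac (W + real j * H) - 1/2) \<ge> parab (W + real n * H) - parab W - real n * H\<^sup>2 / 2"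
proof (induction n)
  case (Suc n)
  have "parab (W + real (Suc n) * H) \<le> parab (W + real n * H) + H * (frac (W + real n * H) - 1/2) + H\<^sup>2 / 2"
    using parab_le[of "W + real n * H" H] by (simp add: algebra_simps)
  with Suc show ?case by (simp add: algebra_simps add_divide_distrib)
qed simp

text \<open>The left side is minus the integral of \<open>frac - 1/2\<close> over the interval of
  radius \<open>V\<close> about \<open>c\<close>. The hypothesis says that the interval reaches the
  first integer above \<open>c\<close>. If \<open>V < x\<close>, both end points have explicit
  fractional parts. Otherwise \<open>V\<close> is at least \<open>x\<close> and
  \<open>1 - x\<close>, and the inequalities \<open>1 - 2 * x \<le> (1 - x)\<^sup>2\<close> and
  \<open>2 * x - 1 \<le> x\<^sup>2\<close> finish.\<close>

lemma parab_diff_le: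
  fixes c V :: real
  defines "x \<equiv> frac c"
  assumes V: "1 - x \<le> V"
  shows "parab (c - V) - parab (c + V) \<le> x * (1 - x) * V"
proof -
  have x: "0 \<le> x" "x < 1" by (simp_all add: x_def frac_lt_1)
  define s t where "s = frac (c - V)" and "t = frac (c + V)"
  have s: "0 \<le> s" "s < 1" and t: "0 \<le> t" "t < 1"
    by (simp_all add: s_def t_def frac_lt_1)
  have D: "parab (c - V) - parab (c + V) = (t - s) * (1 - (s + t)) / 2"
    unfolding parab_def s_def[symmetric] t_def[symmetric] by (simp add: field_simps)
  show ?thesis
  proof (cases "V < x")
    case True
    have fc: "c = real_of_int \<lfloor>c\<rfloor> + x" by (simp add: x_def frac_def)
    have "s = x - V"
    proof -
      have "c - V - (x - V) = real_of_int \<lfloor>c\<rfloor>" using fc by simp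
      then have "c - V - (x - V) \<in> \<int>" by (metis Ints_of_int)
      then show ?thesis
        unfolding s_def using True x V by (subst frac_unique_iff) auto
    qed
    moreover have "t = x + V - 1"
    proof -
      have "c + V - (x + V - 1) = real_of_int (\<lfloor>c\<rfloor> + 1)" using fc by simp
      then have "c + V - (x + V - 1) \<in> \<int>" by (metis Ints_of_int)
      then show ?thesis
        unfolding t_def using True x V by (subst frac_unique_iff) auto
    qed
    ultimately have "parab (c - V) - parab (c + V) = (1 - x) * (2 * V - 1)"
      unfolding D by (simp only:) (simp add: field_simps)
    also have "\<dots> \<le> (1 - x) * (x * V)"
    proof (rule mult_left_mono)
      have "V * (2 - x) \<le> x * (2 - x)" using True x by (intro mult_right_mono) auto
      also have "\<dots> \<le> 1" using zero_le_power2[of "1 - x"] by (simp add: power2_eq_square algebra_simps)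
      finally show "2 * V - 1 \<le> x * V" by (simp add: algebra_simps)
    qed (use x in simp)
    finally show ?thesis by (simp add: mult_ac)
  next
    case False
    have 0: "0 \<le> V" using V x by linarith
    \<comment> \<open>The end points are symmetric about \<open>c\<close>, so \<open>s + t\<close>
      is determined modulo 1. This leaves three values of \<open>j\<close>, and \<open>s, t\<close>
      in the unit interval bound their difference in terms of their sum.\<close>
    obtain j :: int where j: "s + t = 2 * x + real_of_int j"
    proof
      show "s + t = 2 * x + real_of_int (2 * \<lfloor>c\<rfloor> - \<lfloor>c - V\<rfloor> - \<lfloor>c + V\<rfloor>)"
        by (simp add: s_def t_def x_def frac_def)
    qed
    have half: "x * (1 - 2 * x) \<le> x * (1 - x) * V" if "x \<le> 1/2"
    proof -
      have "x * (1 - 2 * x) \<le> x * ((1 - x) * (1 - x))"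
        using x by (intro mult_left_mono) (auto simp: algebra_simps)
      also have "\<dots> \<le> x * ((1 - x) * V)"
        using x V by (intro mult_left_mono) auto
      finally show ?thesis by (simp add: mult_ac)
    qed
    have half': "(1 - x) * (2 * x - 1) \<le> x * (1 - x) * V"
    proof -
      have "2 * x - 1 \<le> x * x" using zero_le_power2[of "1 - x"] by (simp add: power2_eq_square algebra_simps)
      also have "\<dots> \<le> x * V" using False x by (intro mult_left_mono) auto
      finally have "(1 - x) * (2 * x - 1) \<le> (1 - x) * (x * V)"
        using x by (intro mult_left_mono) auto
      then show ?thesis by (simp add: mult_ac)
    qed
    have "real_of_int j < 2" "-2 < real_of_int j" using j s t x by auto
    then have "j < 2" "-2 < j" by linarith+
    then consider "j = -1" | "j = 0" "x \<le> 1/2" | "j = 0" "1/2 < x" | "j = 1" by linarith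
    then show ?thesis
    proof cases
      case 1
      have "(t - s) * (1 - (s + t)) \<le> (2 * x - 1) * (2 - 2 * x)"
        using j 1 s t x by (intro mult_mono) auto
      also have "\<dots> = 2 * ((1 - x) * (2 * x - 1))" by (simp add: algebra_simps)
      finally show ?thesis unfolding D using half' by linarith
    next
      case 2
      have "(t - s) * (1 - (s + t)) \<le> (2 * x) * (1 - 2 * x)"
        using j 2 s t x by (intro mult_mono) auto
      then show ?thesis unfolding D using half[OF 2(2)] by linarith
    next
      case 3
      have "(s - t) * (s + t - 1) \<le> (2 - 2 * x) * (2 * x - 1)"
        using j 3 s t x by (intro mult_mono) auto
      moreover have "(s - t) * (s + t - 1) = (t - s) * (1 - (s + t))" by (simp add: algebra_simps)
      moreover have "(2 - 2 * x) * (2 * x - 1) = 2 * ((1 - x) * (2 * x - 1))" by (simp add: algebra_simps)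
      ultimately show ?thesis unfolding D using half' by linarith
    next
      case 4
      have "x \<le> 1/2" using j 4 s t by simp
      have "(s - t) * (s + t - 1) \<le> (1 - 2 * x) * (2 * x)"
        using j 4 s t x \<open>x \<le> 1/2\<close> by (intro mult_mono) auto
      moreover have "(s - t) * (s + t - 1) = (t - s) * (1 - (s + t))" by (simp add: algebra_simps)
      moreover have "(1 - 2 * x) * (2 * x) = 2 * (x * (1 - 2 * x))" by (simp add: algebra_simps)
      ultimately show ?thesis unfolding D using half[OF \<open>x \<le> 1/2\<close>] by linarith
    qed
  qed
qed

text \<open>The interval is recentred at \<open>\<nu>\<close> and lengthened to radius
  \<open>W\<close>, so that it still reaches the next integer. Of the 5, one unit pays for the
  longer radius and four for moving the end points by the Lipschitz bound.\<close>

lemma parab_diff_le_perturbed: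
  fixes c \<nu> V h :: real
  defines "x \<equiv> frac \<nu>"
  assumes "0 \<le> h" "0 \<le> V" "\<nu> \<le> c" "c - \<nu> \<le> h * V" "real_of_int \<lfloor>\<nu>\<rfloor> + 1 \<le> c + V"
  shows "parab (c - V) - parab (c + V) \<le> (x * (1 - x) + 5 * h) * V"
proof -
  have x: "0 \<le> x" "x < 1" by (simp_all add: x_def frac_lt_1)
  define W where "W = V + h * V"
  have "1 - x \<le> W" using assms by (simp add: W_def x_def frac_def)
  then have "parab (\<nu> - W) - parab (\<nu> + W) \<le> x * (1 - x) * W"
    using parab_diff_le[of \<nu> W] by (simp add: x_def)
  also have "\<dots> = x * (1 - x) * V + x * (1 - x) * (h * V)" by (simp add: W_def algebra_simps)
  also have "x * (1 - x) * (h * V) \<le> 1 * (h * V)"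
    using x assms by (intro mult_right_mono mult_le_one) auto
  finally have "parab (\<nu> - W) - parab (\<nu> + W) \<le> x * (1 - x) * V + h * V" by simp
  moreover have "\<bar>parab (c - V) - parab (\<nu> - W)\<bar> \<le> \<bar>(c - V) - (\<nu> - W)\<bar>"
    "\<bar>parab (c + V) - parab (\<nu> + W)\<bar> \<le> \<bar>(c + V) - (\<nu> + W)\<bar>"
    by (rule parab_lipschitz)+
  moreover have "\<bar>(c - V) - (\<nu> - W)\<bar> + \<bar>(c + V) - (\<nu> + W)\<bar> \<le> 4 * (h * V)"
    using assms by (simp add: W_def)
  ultimately have "parab (c - V) - parab (c + V) \<le> x * (1 - x) * V + 5 * (h * V)" by linarith
  then show ?thesis by (simp add: algebra_simps)
qed

section \<open>Slopes close to a rational\<close>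

text \<open>With \<open>u\<^sub>k = q a \<beta> - k g\<close> the column height \<open>(a - k) \<beta>\<close> is \<open>(u\<^sub>k - k p) / q\<close>. In a block of \<open>q\<close> columns
  the residues of \<open>k p\<close> run through everything once, so only the largest \<open>u\<^sub>k\<close> of the block matters.\<close>

lemma sum_frac_columns_ge:
  fixes a \<beta> :: real and p q :: nat
  assumes "coprime p q" "q > 0"
  defines "g \<equiv> real q * \<beta> - real p"
  defines "J \<equiv> nat \<lfloor>a\<rfloor> div q"
  shows "(\<Sum>k<nat \<lfloor>a\<rfloor>. frac ((a - real (Suc k)) * \<beta>)) \<ge> real J * ((real q - 1) / 2 - real q * \<bar>g\<bar>)
     + (\<Sum>j<J. frac (real q * a * \<beta> - (if g \<ge> 0 then g else real q * g) - real j * (real q * g)))"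
proof -
  let ?y = "\<lambda>k. frac ((a - real (Suc k)) * \<beta>)"
  let ?U = "\<lambda>j. real q * a * \<beta> - (if g \<ge> 0 then g else real q * g) - real j * (real q * g)"
  have y: "(a - real k) * \<beta> = ((real q * a * \<beta> - real k * g) - real k * real p) / real q" for k
    using assms(2) by (simp add: g_def field_simps)
  have "(\<Sum>k\<in>{j*q..<j*q+q}. ?y k) \<ge> frac (?U j) + ((real q - 1) / 2 - real q * \<bar>g\<bar>)" for j
  proof -
    have "(\<Sum>k\<in>{j*q..<j*q+q}. ?y k) = (\<Sum>k\<in>{Suc (j*q)..<Suc (j*q)+q}. frac ((a - real k) * \<beta>))"
      using sum.shift_bounds_Suc_ivl[of "\<lambda>k. frac ((a - real k) * \<beta>)" "j*q" "j*q+q"] by simp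
    also have "\<dots> \<ge> frac (?U j) + (real q - 1) / 2 - real q * \<bar>g\<bar>"
      unfolding y
    proof (rule sum_frac_block_ge[OF assms(1,2)])
      fix i assume i: "i \<in> {Suc (j*q)..<Suc (j*q)+q}"
      \<comment> \<open>Columns are numbered from 1, so the position \<open>d\<close> in a block
        runs from 1 to \<open>q\<close>. The largest \<open>u\<close> of the block occurs at
        \<open>d = 1\<close> if \<open>g \<ge> 0\<close> and at \<open>d = q\<close> otherwise,
        whence the conditional in the statement.\<close>
      define d where "d = real i - real j * real q"
      have "real (Suc (j*q)) \<le> real i" "real i \<le> real (j*q + q)"
        using i by (auto simp only: of_nat_le_iff atLeastLessThan_iff)
      then have d: "1 \<le> d" "d \<le> real q" by (auto simp: d_def)
      have ig: "real i * g = real j * (real q * g) + d * g" by (simp add: d_def algebra_simps)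
      show "real q * a * \<beta> - real i * g \<le> ?U j \<and> ?U j - real q * \<bar>g\<bar> \<le> real q * a * \<beta> - real i * g"
      proof (cases "g \<ge> 0")
        case True
        have "g \<le> d * g" using d True by (simp add: mult_le_cancel_right1)
        moreover have "d * g \<le> real q * g" using d True by (intro mult_right_mono) auto
        ultimately show ?thesis using True by (simp add: ig)
      next
        case False
        have "d * g \<le> 0" using d False by (intro mult_nonneg_nonpos) auto
        moreover have "real q * g \<le> d * g" using d False by (intro mult_right_mono_neg) auto
        ultimately show ?thesis using False by (simp add: ig)
      qed
    qed
    finally show ?thesis by simp
  qed
  then have "(\<Sum>j<J. frac (?U j) + ((real q - 1) / 2 - real q * \<bar>g\<bar>)) \<le> (\<Sum>j<J. \<Sum>k\<in>{j*q..<j*q+q}. ?y k)"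
    by (rule sum_mono)
  also have "\<dots> = (\<Sum>k<J*q. ?y k)"
    by (rule sum.nat_group)
  also have "\<dots> \<le> (\<Sum>k<nat \<lfloor>a\<rfloor>. ?y k)"
    by (rule sum_mono2) (auto simp: J_def intro: less_le_trans[OF _ div_times_less_eq_dividend])
  finally show ?thesis
    unfolding sum.distrib sum_constant card_lessThan by (simp only: add.commute)
qed

lemma block_number_bounds:
  fixes a :: real and q :: nat
  assumes "a > 0" "q > 0"
  defines "J \<equiv> nat \<lfloor>a\<rfloor> div q"
  shows "real J * real q \<le> a" "a - real q \<le> real J * real q"
proof -
  have K: "real (nat \<lfloor>a\<rfloor>) \<le> a" "a - 1 < real (nat \<lfloor>a\<rfloor>)" using assms(1) by linarith+
  have "J * q \<le> nat \<lfloor>a\<rfloor>" by (simp add: J_def)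
  then have "real J * real q \<le> real (nat \<lfloor>a\<rfloor>)" by (metis of_nat_le_iff of_nat_mult)
  with K show "real J * real q \<le> a" by simp
  have "nat \<lfloor>a\<rfloor> < J * q + q"
    using assms(2) by (metis J_def add.commute div_mult_mod_eq mod_less_divisor nat_add_left_cancel_less)
  then have "nat \<lfloor>a\<rfloor> + 1 \<le> J * q + q" by simp
  then have "real (nat \<lfloor>a\<rfloor>) + 1 \<le> real J * real q + real q"
    by (metis of_nat_1 of_nat_add of_nat_le_iff of_nat_mult)
  with K show "a - real q \<le> real J * real q" by linarith
qed

text \<open>As \<open>k\<close> runs over \<open>[0, a]\<close>, the numbers \<open>u\<^sub>k\<close> sweep the interval with centre \<open>c\<close> and radius \<open>V\<close>.\<close>

lemma sum_frac_samples_ge: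
  fixes a \<beta> g :: real and q :: nat
  assumes "a > 0" "q > 0"
  defines "H \<equiv> real q * \<bar>g\<bar>"
  defines "c \<equiv> real q * a * \<beta> - a * g / 2" and "V \<equiv> a * \<bar>g\<bar> / 2"
  defines "J \<equiv> nat \<lfloor>a\<rfloor> div q"
  shows "H * (\<Sum>j<J. frac (real q * a * \<beta> - (if g \<ge> 0 then g else real q * g) - real j * (real q * g)) - 1/2)
    \<ge> parab (c + V) - parab (c - V) - 4 * H - real J * H\<^sup>2 / 2"
proof -
  have J: "real J * real q \<le> a" "a - real q \<le> real J * real q"
    unfolding J_def using block_number_bounds[OF assms(1,2)] by auto
  have q1: "real q \<ge> 1" using assms(2) by simp
  \<comment> \<open>For either sign of \<open>g\<close> the samples form an increasing progression
    with step \<open>H\<close>. Its ends lie within \<open>2 * H\<close> of the ends of the swept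
    interval, which accounts for the \<open>4 * H\<close>.\<close>
  have *: ?thesis
    if "(\<Sum>j<J. frac (real q * a * \<beta> - (if g \<ge> 0 then g else real q * g) - real j * (real q * g)) - 1/2) =
      (\<Sum>j<J. frac (W + real j * H) - 1/2)"
      and "\<bar>W - (c - V)\<bar> \<le> 2 * H" "\<bar>W + real J * H - (c + V)\<bar> \<le> 2 * H" for W
    unfolding that(1) using sum_frac_progression_ge[of W J H] that(2,3)
      parab_lipschitz[of W "c - V"] parab_lipschitz[of "W + real J * H" "c + V"] by linarith
  show ?thesis
  proof (cases "g \<ge> 0")
    case True
    \<comment> \<open>Here the samples decrease, so they are read backwards from the last one, which
      is \<open>W\<close>.\<close>
    define W where "W = real q * a * \<beta> - g - (real J - 1) * H"
    have "(\<Sum>j<J. frac (real q * a * \<beta> - g - real j * (real q * g)) - 1/2) =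
        (\<Sum>j<J. frac (real q * a * \<beta> - g - real (J - Suc j) * (real q * g)) - 1/2)"
      by (rule sum.nat_diff_reindex[symmetric])
    also have "\<dots> = (\<Sum>j<J. frac (W + real j * H) - 1/2)"
      using True by (intro sum.cong) (auto simp: W_def H_def of_nat_diff algebra_simps)
    finally have 1: "(\<Sum>j<J. frac (real q * a * \<beta> - g - real j * (real q * g)) - 1/2) =
        (\<Sum>j<J. frac (W + real j * H) - 1/2)" .
    have "W - (c - V) = g * (a - 1 - real J * real q + real q)"
      using True by (simp add: W_def c_def V_def H_def algebra_simps)
    moreover have "0 \<le> g * (a - 1 - real J * real q + real q)"
      using True J q1 by (intro mult_nonneg_nonneg) auto
    moreover have "g * (a - 1 - real J * real q + real q) \<le> g * (2 * real q)"
      using True J q1 by (intro mult_left_mono) auto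
    ultimately have 2: "\<bar>W - (c - V)\<bar> \<le> 2 * H" using True by (simp add: H_def mult_ac)
    have "W + real J * H - (c + V) = H - g"
      using True by (simp add: W_def c_def V_def H_def algebra_simps)
    moreover have "g \<le> H" "H = real q * g" using True q1 by (simp_all add: H_def mult_le_cancel_right1)
    ultimately have 3: "\<bar>W + real J * H - (c + V)\<bar> \<le> 2 * H" using True by linarith
    show ?thesis using *[of W] 1 2 3 True by simp
  next
    case False
    define W where "W = real q * a * \<beta> + H"
    have 1: "(\<Sum>j<J. frac (real q * a * \<beta> - (if g \<ge> 0 then g else real q * g) - real j * (real q * g)) - 1/2) =
        (\<Sum>j<J. frac (W + real j * H) - 1/2)"
      using False by (intro sum.cong) (auto simp: W_def H_def algebra_simps)
    have H0: "0 \<le> H" by (simp add: H_def)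
    have 2: "\<bar>W - (c - V)\<bar> \<le> 2 * H"
      using False H0 by (simp add: W_def c_def V_def algebra_simps)
    have "W + real J * H - (c + V) = H - (a - real J * real q) * (- g)"
      using False by (simp add: W_def c_def V_def H_def algebra_simps)
    moreover have "0 \<le> (a - real J * real q) * (- g)"
      using False J by (intro mult_nonneg_nonneg) auto
    moreover have "(a - real J * real q) * (- g) \<le> H"
      using False J mult_right_mono[of "a - real J * real q" "real q" "- g"] by (simp add: H_def)
    ultimately have 3: "\<bar>W + real J * H - (c + V)\<bar> \<le> 2 * H" using H0 by linarith
    show ?thesis by (rule *[OF 1 2 3])
  qed
qed

text \<open>The last inequality is that of the arithmetic and geometric means. It turns a loss of
  \<open>a / 2 + a * \<beta> / 2\<close> into a loss of at least \<open>\<alpha>\<close>.\<close>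

lemma intercept_bounds:
  fixes \<alpha> \<beta> :: real
  assumes "\<alpha> > 0" "\<beta> > 0" and a: "a = \<alpha> / sqrt \<beta>"
  shows "a > 0" "a * \<beta> = \<alpha> * sqrt \<beta>" "a * sqrt \<beta> = \<alpha>" "2 * \<alpha> \<le> a + a * \<beta>"
proof -
  have s: "sqrt \<beta> > 0" "sqrt \<beta> * sqrt \<beta> = \<beta>" using assms by auto
  show 1: "a > 0" using assms by simp
  show 2: "a * sqrt \<beta> = \<alpha>" using s by (simp add: a)
  then show "a * \<beta> = \<alpha> * sqrt \<beta>" by (metis mult.assoc s(2))
  have "0 \<le> a * (sqrt \<beta> - 1)\<^sup>2" using 1 by simp
  also have "\<dots> = a * (sqrt \<beta> * sqrt \<beta>) + a - 2 * (a * sqrt \<beta>)"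
    by (simp add: power2_eq_square algebra_simps)
  finally show "2 * \<alpha> \<le> a + a * \<beta>" unfolding s 2 by linarith
qed

text \<open>\<open>c\<close> is \<open>a\<close> times the arithmetic mean of \<open>p\<close> and
  \<open>q * \<beta>\<close>, whereas \<open>\<alpha> * sqrt (p * q)\<close> is \<open>a\<close>
  times their geometric mean. The difference is \<open>a / 2\<close> times the square of the
  difference of the roots, which is second order in \<open>g\<close>.\<close>

lemma center_bounds:
  fixes \<alpha> \<beta> g :: real and p q :: nat
  assumes "\<alpha> > 0" "\<beta> > 0" "p > 0" "a = \<alpha> / sqrt \<beta>" "g = real q * \<beta> - real p"
  defines "c \<equiv> real q * a * \<beta> - a * g / 2"
  shows "\<alpha> * sqrt (real p * real q) \<le> c" "c - \<alpha> * sqrt (real p * real q) \<le> \<bar>g\<bar> * (a * \<bar>g\<bar> / 2)"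
proof -
  note ab = intercept_bounds[OF assms(1,2,4)]
  define X Y where "X = sqrt (real p)" and "Y = sqrt (real q * \<beta>)"
  have XY: "X \<ge> 1" "Y \<ge> 0" "X * X = real p" "Y * Y = real q * \<beta>"
    using assms(2,3) by (auto simp: X_def Y_def)
  have "\<alpha> * sqrt (real p * real q) = a * (X * Y)"
    unfolding X_def Y_def ab(3)[symmetric] by (simp add: real_sqrt_mult)
  moreover have "c = a / 2 * (X * X + Y * Y)"
    unfolding XY c_def assms(5) by (simp add: field_simps)
  ultimately have c: "c - \<alpha> * sqrt (real p * real q) = a / 2 * (X - Y)\<^sup>2"
    by (simp add: power2_eq_square field_simps)
  show "\<alpha> * sqrt (real p * real q) \<le> c"
    using c ab(1) by (metis diff_ge_0_iff_ge divide_nonneg_pos less_imp_le mult_nonneg_nonneg zero_le_power2 zero_less_numeral)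
  have "\<bar>X - Y\<bar> * 1 \<le> \<bar>X - Y\<bar> * (X + Y)" using XY by (intro mult_left_mono) auto
  also have "\<dots> = \<bar>g\<bar>"
  proof -
    have "g = (Y - X) * (X + Y)" unfolding assms(5) XY(3,4)[symmetric] by (simp add: algebra_simps)
    then show ?thesis using XY by (simp add: abs_mult abs_minus_commute)
  qed
  finally have "(X - Y)\<^sup>2 \<le> g\<^sup>2" by (simp add: abs_le_square_iff[symmetric])
  then have "a / 2 * (X - Y)\<^sup>2 \<le> a / 2 * g\<^sup>2" using ab(1) by (intro mult_left_mono) auto
  then show "c - \<alpha> * sqrt (real p * real q) \<le> \<bar>g\<bar> * (a * \<bar>g\<bar> / 2)"
    unfolding c using abs_mult_self_eq[of g] by (simp add: power2_eq_square mult_ac)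
qed

text \<open>A point \<open>(k, m)\<close> under slope \<open>\<beta>\<close> satisfies
  \<open>q * m + p * k \<le> u\<^sub>k\<close>, which is at most the right end of the swept
  interval. The left side is an integer, so if that end stays below the next integer after
  \<open>\<alpha> * sqrt (p * q)\<close>, the point also lies in the triangle of slope
  \<open>p / q\<close>. The alternative is the crossing condition that the estimate of
  \<open>parab\<close> needs.\<close>

lemma lattice_count_le_or_crossing:
  fixes \<alpha> \<beta> g :: real and p q :: nat
  assumes "\<alpha> > 0" "\<beta> > 0" "p > 0" "q > 0" "a = \<alpha> / sqrt \<beta>" "g = real q * \<beta> - real p"
  shows "lattice_count \<beta> \<alpha> \<le> lattice_count (real p / real q) \<alpha> \<or>
    g \<noteq> 0 \<and> real_of_int \<lfloor>\<alpha> * sqrt (real p * real q)\<rfloor> + 1 \<le> (real q * a * \<beta> - a * g / 2) + a * \<bar>g\<bar> / 2"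
proof -
  note ab = intercept_bounds[OF assms(1,2,5)]
  let ?\<nu> = "\<alpha> * sqrt (real p * real q)"
  define top where "top = (real q * a * \<beta> - a * g / 2) + a * \<bar>g\<bar> / 2"
  have "lattice_count \<beta> \<alpha> \<le> lattice_count (real p / real q) \<alpha>"
    if small: "g = 0 \<or> top < real_of_int \<lfloor>?\<nu>\<rfloor> + 1"
  proof (cases "g = 0")
    case True
    then have "\<beta> = real p / real q" using assms by (simp add: field_simps)
    then show ?thesis by simp
  next
    case False
    with small have top: "top < real_of_int \<lfloor>?\<nu>\<rfloor> + 1" by simp
    have \<gamma>: "real p / real q > 0" using assms by simp
    let ?A = "\<lambda>\<beta>. {(k::int, m::int). k > 0 \<and> m > 0 \<and> real_of_int m \<le> \<alpha> * sqrt \<beta> - real_of_int k * \<beta>}"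
    have "0 < k \<and> 0 < m \<and> real_of_int m \<le> \<alpha> * sqrt (real p / real q) - real_of_int k * (real p / real q)"
      if km: "0 < k" "0 < m" "real_of_int m \<le> \<alpha> * sqrt \<beta> - real_of_int k * \<beta>" for k m :: int
    proof -
      from km(2,3) have "0 < (a - real_of_int k) * \<beta>" by (simp add: ab(2)[symmetric] algebra_simps)
      then have k: "real_of_int k < a" using assms(2) by (simp add: zero_less_mult_iff)
      have "real q * real_of_int m \<le> real q * (a * \<beta> - real_of_int k * \<beta>)"
        using km(3) ab(2) by (intro mult_left_mono) auto
      then have "real q * real_of_int m + real p * real_of_int k \<le> real q * a * \<beta> - real_of_int k * g"
        unfolding assms(6) by (simp add: algebra_simps)
      also have "\<dots> \<le> top"
      proof (cases "g \<ge> 0")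
        case True
        then show ?thesis using km(1) by (simp add: top_def)
      next
        case False
        then have "a * g \<le> real_of_int k * g" using k by (intro mult_right_mono_neg) auto
        with False show ?thesis by (simp add: top_def)
      qed
      finally have "real_of_int (int q * m + int p * k) < real_of_int (\<lfloor>?\<nu>\<rfloor> + 1)" using top by simp
      then have "int q * m + int p * k \<le> \<lfloor>?\<nu>\<rfloor>" by linarith
      then have le: "real q * real_of_int m + real p * real_of_int k \<le> ?\<nu>" by (simp add: le_floor_iff)
      have "sqrt (real p * real q) = real q * sqrt (real p / real q)"
        using assms(4) by (simp add: real_sqrt_mult real_sqrt_divide field_simps)
      with le have "real q * real_of_int m \<le> real q * (\<alpha> * sqrt (real p / real q) - real_of_int k * (real p / real q))"
        using assms(4) by (simp add: algebra_simps)
      then have "real_of_int m \<le> \<alpha> * sqrt (real p / real q) - real_of_int k * (real p / real q)"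
        using assms(4) by simp
      with km(1,2) show ?thesis by simp
    qed
    then have "?A \<beta> \<subseteq> ?A (real p / real q)" by auto
    moreover have "finite (?A (real p / real q))"
      unfolding lattice_triangle_eq[OF assms(1) \<gamma> refl] by simp
    ultimately show ?thesis unfolding lattice_count_def by (rule card_mono[rotated])
  qed
  then show ?thesis unfolding top_def by (meson not_less)
qed

lemma lattice_count_le_sum:
  fixes \<alpha> \<beta> :: real
  assumes "\<alpha> > 0" "\<beta> > 0" "a = \<alpha> / sqrt \<beta>"
    and "B \<le> (\<Sum>k<nat \<lfloor>a\<rfloor>. frac ((a - real (Suc k)) * \<beta>))"
  shows "real (lattice_count \<beta> \<alpha>) \<le> \<alpha>\<^sup>2 / 2 - a * \<beta> / 2 + \<beta> / 8 - B"
proof -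
  have "frac a * (1 - frac a) \<le> 1 / 4"
    using parab_bounds(1)[of a] by (simp add: parab_def algebra_simps)
  then have "\<beta> * (frac a * (1 - frac a)) \<le> \<beta> * (1 / 4)" using assms(2) by (intro mult_left_mono) auto
  then show ?thesis using lattice_count_frac[OF assms(1-3)] assms(4) by linarith
qed

text \<open>If \<open>p / q\<close> is not at least as good, the crossing condition holds and
  \<open>parab_diff_le_perturbed\<close> bounds the sum of fractional parts. In
  \<open>8 * H\<close>, five come from that lemma, two from the variation inside blocks and one from
  the quadratic error of the progression. The 6 is 4 from the ends of the progression plus
  \<open>\<beta> / 8 \<le> 2\<close>.\<close>

lemma lattice_count_le_or_upper:
  fixes \<alpha> \<beta> :: real and p q :: nat
  assumes "\<alpha> > 0" "\<beta> > 0" "\<beta> \<le> 16" "p > 0" "q > 0" "coprime p q" "a = \<alpha> / sqrt \<beta>"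
  defines "x \<equiv> frac (\<alpha> * sqrt (real p * real q))"
  defines "H \<equiv> real q * \<bar>real q * \<beta> - real p\<bar>"
  shows "lattice_count \<beta> \<alpha> \<le> lattice_count (real p / real q) \<alpha> \<or>
    real (lattice_count \<beta> \<alpha>) \<le> \<alpha>\<^sup>2 / 2 - \<alpha> + a / (2 * real q) * (x * (1 - x) + 8 * H) + real q + 6"
proof (rule disjCI)
  assume nle: "\<not> real (lattice_count \<beta> \<alpha>) \<le> \<alpha>\<^sup>2 / 2 - \<alpha> + a / (2 * real q) * (x * (1 - x) + 8 * H) + real q + 6"
  show "lattice_count \<beta> \<alpha> \<le> lattice_count (real p / real q) \<alpha>"
  proof (rule ccontr)
    assume nle': "\<not> lattice_count \<beta> \<alpha> \<le> lattice_count (real p / real q) \<alpha>"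
    note ab = intercept_bounds[OF assms(1,2,7)]
    define g where "g = real q * \<beta> - real p"
    define c V where "c = real q * a * \<beta> - a * g / 2" and "V = a * \<bar>g\<bar> / 2"
    define J where "J = nat \<lfloor>a\<rfloor> div q"
    define U where "U j = real q * a * \<beta> - (if g \<ge> 0 then g else real q * g) - real j * (real q * g)" for j
    define F where "F = (\<Sum>j<J. frac (U j))"
    let ?\<nu> = "\<alpha> * sqrt (real p * real q)"
    have H: "H = real q * \<bar>g\<bar>" by (simp add: H_def g_def)
    have q1: "real q \<ge> 1" using assms(5) by simp
    from lattice_count_le_or_crossing[OF assms(1,2,4,5,7) g_def] nle'
    have g0: "g \<noteq> 0" and cross: "real_of_int \<lfloor>?\<nu>\<rfloor> + 1 \<le> c + V"
      by (auto simp: c_def V_def)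
    have Hpos: "H > 0" using g0 assms(5) by (simp add: H)
    have gH: "\<bar>g\<bar> \<le> H" using q1 by (simp add: H mult_le_cancel_right1)
    have V0: "0 \<le> V" using ab(1) by (simp add: V_def)
    have J: "real J * real q \<le> a" "a - real q \<le> real J * real q"
      unfolding J_def using block_number_bounds[OF ab(1) assms(5)] by auto
    \<comment> \<open>The radius is proportional to \<open>H\<close>, so the positive factor
      \<open>H\<close> can be cancelled below however small the tilt is.\<close>
    have VH: "V = a / (2 * real q) * H" using assms(5) by (simp add: V_def H)
    have "parab (c - V) - parab (c + V) \<le> (x * (1 - x) + 5 * \<bar>g\<bar>) * V"
      unfolding x_def
      using center_bounds[OF assms(1,2,4,7) g_def] V0 cross
      by (intro parab_diff_le_perturbed) (auto simp: c_def V_def)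
    also have "\<dots> \<le> (x * (1 - x) + 5 * H) * V"
      using gH V0 by (intro mult_right_mono) auto
    finally have D: "parab (c - V) - parab (c + V) \<le> H * (a / (2 * real q) * (x * (1 - x) + 5 * H))"
      unfolding VH by (simp add: mult_ac)
    have "H * (F - real J / 2) \<ge> parab (c + V) - parab (c - V) - 4 * H - real J * H\<^sup>2 / 2"
    proof -
      have "(\<Sum>j<J. frac (U j) - 1/2) = F - real J / 2" by (simp add: F_def sum_subtractf)
      then show ?thesis
        using sum_frac_samples_ge[OF ab(1) assms(5), of \<beta> g]
        by (simp only: H c_def V_def J_def[symmetric] U_def)
    qed
    with D have "H * (F - real J / 2) \<ge> H * (- (a / (2 * real q) * (x * (1 - x) + 5 * H)) - 4 - real J * H / 2)"
      by (simp add: algebra_simps power2_eq_square)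
    then have F: "F \<ge> real J / 2 - a / (2 * real q) * (x * (1 - x) + 5 * H) - 4 - real J * H / 2"
      using Hpos by simp
    have "real J * H \<le> a / real q * H"
      using J(1) assms(5) Hpos by (intro mult_right_mono) (auto simp: field_simps)
    then have JH: "real J * H \<le> a / (2 * real q) * (2 * H)" by simp
    have "(\<Sum>k<nat \<lfloor>a\<rfloor>. frac ((a - real (Suc k)) * \<beta>)) \<ge> real J * ((real q - 1) / 2 - H) + F"
      unfolding F_def U_def J_def H g_def by (rule sum_frac_columns_ge[OF assms(6,5)])
    also have "real J * ((real q - 1) / 2 - H) + F \<ge>
        real J * ((real q - 1) / 2 - H) + (real J / 2 - a / (2 * real q) * (x * (1 - x) + 5 * H) - 4 - real J * H / 2)"
      using F by simp
    also have "real J * ((real q - 1) / 2 - H) + (real J / 2 - a / (2 * real q) * (x * (1 - x) + 5 * H) - 4 - real J * H / 2)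
        = real J * real q / 2 - 3 / 2 * (real J * H) - a / (2 * real q) * (x * (1 - x) + 5 * H) - 4"
      by (simp add: field_simps)
    also have "\<dots> \<ge> (a - real q) / 2 - 3 / 2 * (a / (2 * real q) * (2 * H)) - a / (2 * real q) * (x * (1 - x) + 5 * H) - 4"
      by (intro diff_mono mult_left_mono[OF JH] divide_right_mono[OF J(2)] order_refl) simp_all
    also have "(a - real q) / 2 - 3 / 2 * (a / (2 * real q) * (2 * H)) - a / (2 * real q) * (x * (1 - x) + 5 * H) - 4
        = (a - real q) / 2 - a / (2 * real q) * (x * (1 - x) + 8 * H) - 4"
      by (simp add: algebra_simps add_divide_distrib)
    finally have "(a - real q) / 2 - a / (2 * real q) * (x * (1 - x) + 8 * H) - 4
        \<le> (\<Sum>k<nat \<lfloor>a\<rfloor>. frac ((a - real (Suc k)) * \<beta>))" .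
    from lattice_count_le_sum[OF assms(1,2,7) this] nle ab(4) assms(3) q1
    show False by argo
  qed
qed

text \<open>A block of \<open>q\<close> columns falls short of the sum \<open>q / 2\<close> by at
  most \<open>1/2 + H \<le> 3/2\<close>, even if the fractional part of its largest \<open>u\<close>
  is estimated by 0. There are at most \<open>a / q\<close> blocks, so the total shortfall is small
  for large \<open>q\<close>.\<close>

lemma lattice_count_le_large_denominator:
  fixes \<alpha> \<beta> :: real and p q :: nat
  assumes "\<alpha> > 0" "\<beta> > 0" "\<beta> \<le> 16" "q > 0" "coprime p q" "a = \<alpha> / sqrt \<beta>"
    and H: "real q * \<bar>real q * \<beta> - real p\<bar> \<le> 1"
  shows "real (lattice_count \<beta> \<alpha>) \<le> \<alpha>\<^sup>2 / 2 - \<alpha> + 3 * a / (2 * real q) + real q + 6"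
proof -
  note ab = intercept_bounds[OF assms(1,2,6)]
  define J where "J = nat \<lfloor>a\<rfloor> div q"
  have J: "real J * real q \<le> a" "a - real q \<le> real J * real q"
    unfolding J_def using block_number_bounds[OF ab(1) assms(4)] by auto
  have "3 / 2 * real J \<le> 3 * a / (2 * real q)" using J(1) assms(4) by (simp add: field_simps)
  then have "(a - real q) / 2 - 3 * a / (2 * real q) \<le> real J * real q / 2 - 3 / 2 * real J"
    using J(2) by (intro diff_mono) auto
  also have "\<dots> = real J * ((real q - 1) / 2 - 1)" by (simp add: field_simps)
  also have "\<dots> \<le> real J * ((real q - 1) / 2 - real q * \<bar>real q * \<beta> - real p\<bar>)"
    using H by (intro mult_left_mono) auto
  also have "\<dots> \<le> (\<Sum>k<nat \<lfloor>a\<rfloor>. frac ((a - real (Suc k)) * \<beta>))"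
    by (rule order_trans[OF _ sum_frac_columns_ge[OF assms(5,4)]]) (simp add: J_def sum_nonneg)
  finally have "(a - real q) / 2 - 3 * a / (2 * real q) \<le> (\<Sum>k<nat \<lfloor>a\<rfloor>. frac ((a - real (Suc k)) * \<beta>))" .
  from lattice_count_le_sum[OF assms(1,2,6) this] ab(4) assms(3) assms(4)[folded of_nat_0_less_iff[where 'a = real]]
  show ?thesis by argo
qed

section \<open>Counts at rational slopes\<close>

lemma sum_frac_rational:
  fixes \<alpha> :: real and p q :: nat
  assumes "p > 0" "q > 0" "coprime p q" "a = \<alpha> / sqrt (real p / real q)"
  shows "(\<Sum>k<n * q. frac ((a - real (Suc k)) * (real p / real q)))
    = real n * (frac (\<alpha> * sqrt (real p * real q)) + (real q - 1) / 2)"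
proof -
  let ?y = "\<lambda>k. frac ((a - real (Suc k)) * (real p / real q))"
  have "a * real p = \<alpha> * sqrt (real p * real q)"
  proof -
    have "a * real p = \<alpha> * sqrt (real q) * (real p / sqrt (real p))"
      using assms by (simp add: real_sqrt_divide)
    then show ?thesis unfolding real_div_sqrt[OF of_nat_0_le_iff] by (simp add: real_sqrt_mult mult_ac)
  qed
  then have y: "(a - real k) * (real p / real q) = (\<alpha> * sqrt (real p * real q) - real k * real p) / real q" for k
    by (simp add: algebra_simps diff_divide_distrib)
  have "(\<Sum>k\<in>{j*q..<j*q+q}. ?y k) = frac (\<alpha> * sqrt (real p * real q)) + (real q - 1) / 2" for j
  proof -
    have "(\<Sum>k\<in>{j*q..<j*q+q}. ?y k) = (\<Sum>k\<in>{Suc (j*q)..<Suc (j*q)+q}. frac ((a - real k) * (real p / real q)))"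
      using sum.shift_bounds_Suc_ivl[of "\<lambda>k. frac ((a - real k) * (real p / real q))" "j*q" "j*q+q"] by simp
    also have "\<dots> = frac (\<alpha> * sqrt (real p * real q)) + (real q - 1) / 2"
      unfolding y by (rule sum_frac_block[OF assms(3,2)])
    finally show ?thesis .
  qed
  then show ?thesis using sum.nat_group[of ?y q n] by simp
qed

text \<open>For slope exactly \<open>p / q\<close> all complete blocks have the same sum
  \<open>b\<close>. The incomplete last block puts the whole sum between \<open>J * b\<close> and
  \<open>(J + 1) * b\<close>, so that the error does not depend on \<open>\<alpha>\<close>.\<close>

lemma lattice_count_rational_approx:
  fixes \<alpha> :: real and p q :: nat
  assumes "\<alpha> > 0" "p > 0" "q > 0" "coprime p q"
  defines "s \<equiv> sqrt (real p * real q)"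
  shows "\<bar>real (lattice_count (real p / real q) \<alpha>)
      - (\<alpha>\<^sup>2 / 2 - \<alpha> * (real p + real q - 1 + 2 * frac (\<alpha> * s)) / (2 * s))\<bar> \<le> real p + real q"
proof -
  define \<beta> a x where "\<beta> = real p / real q" and "a = \<alpha> / sqrt \<beta>" and "x = frac (\<alpha> * s)"
  define J where "J = nat \<lfloor>a\<rfloor> div q"
  have \<beta>: "\<beta> > 0" using assms by (simp add: \<beta>_def)
  note ab = intercept_bounds[OF assms(1) \<beta> a_def]
  have pq: "real p \<ge> 1" "real q \<ge> 1" using assms(2,3) by auto
  have x: "0 \<le> x" "x < 1" by (simp_all add: x_def frac_lt_1)
  have s: "s > 0" using assms by simp
  have J: "real J * real q \<le> a" "a - real q \<le> real J * real q"
    unfolding J_def using block_number_bounds[OF ab(1) assms(3)] by auto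
  let ?y = "\<lambda>k. frac ((a - real (Suc k)) * \<beta>)"
  define S where "S = (\<Sum>k<nat \<lfloor>a\<rfloor>. ?y k)"
  define b where "b = x + (real q - 1) / 2"
  have b: "0 \<le> b" "b \<le> (real q + 1) / 2" 
  proof -
    show "0 \<le> b" unfolding b_def using x pq by argo
    show "b \<le> (real q + 1) / 2" unfolding b_def using x pq by argo
  qed
  have sumy: "(\<Sum>k<n * q. ?y k) = real n * b" for n
    using sum_frac_rational[OF assms(2-4), of a \<alpha> n] by (simp add: \<beta>_def a_def x_def s_def b_def)
  have as: "a = \<alpha> * real q / s" "a / real q = \<alpha> / s"
  proof -
    have "s = sqrt \<beta> * real q"
      using assms by (simp add: \<beta>_def s_def real_sqrt_mult real_sqrt_divide field_simps)
    then show "a = \<alpha> * real q / s"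
      using pq \<beta> by (simp add: a_def)
    then show "a / real q = \<alpha> / s" using pq by simp
  qed
  have "J * q \<le> nat \<lfloor>a\<rfloor>" by (simp add: J_def)
  then have "real J * b \<le> S"
    unfolding sumy[symmetric] S_def by (intro sum_mono2) auto
  moreover have "S \<le> (real J + 1) * b"
  proof -
    have "nat \<lfloor>a\<rfloor> < Suc J * q"
      using assms(3) by (metis J_def dividend_less_div_times mult.commute mult_Suc_right add.commute mult_Suc)
    then have "S \<le> (\<Sum>k<Suc J * q. ?y k)"
      unfolding S_def by (intro sum_mono2) auto
    then show ?thesis unfolding sumy by (simp add: add.commute)
  qed
  moreover have "a / real q - 1 \<le> real J" "real J \<le> a / real q" using J pq by (simp_all add: field_simps)
  then have "(a / real q - 1) * b \<le> real J * b" "(real J + 1) * b \<le> (a / real q + 1) * b"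
    using b by (intro mult_right_mono; simp)+
  ultimately have S: "a / real q * b - b \<le> S" "S \<le> a / real q * b + b"
    by (simp_all add: algebra_simps)
  have N: "real (lattice_count \<beta> \<alpha>) = \<alpha>\<^sup>2 / 2 - a * \<beta> / 2 + \<beta> * (frac a * (1 - frac a)) / 2 - S"
    unfolding S_def by (rule lattice_count_frac[OF assms(1) \<beta> a_def])
  have "0 \<le> frac a * (1 - frac a)" "frac a * (1 - frac a) \<le> 1 / 4"
    using parab_bounds[of a] by (simp_all add: parab_def algebra_simps)
  then have "0 \<le> \<beta> * (frac a * (1 - frac a))" "\<beta> * (frac a * (1 - frac a)) \<le> \<beta> * (1 / 4)"
    using \<beta> by (simp_all only: mult_left_mono mult_nonneg_nonneg less_imp_le)
  moreover have "\<beta> \<le> real p" using pq by (simp add: \<beta>_def divide_le_eq mult_le_cancel_left1)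
  moreover have "a * \<beta> / 2 + a / real q * b = \<alpha> * (real p + real q - 1 + 2 * x) / (2 * s)"
    unfolding b_def \<beta>_def as(2) using pq s by (simp add: as(1) field_simps)
  ultimately show ?thesis
    using N S b pq unfolding \<beta>_def[symmetric] x_def[symmetric] by (simp add: abs_le_iff)
qed

section \<open>Simultaneous approximation of square roots\<close>

text \<open>Dirichlet's theorem yields \<open>T\<close> with every \<open>T * sqrt d\<close> near an
  integer. Stepping back by \<open>1 / sqrt m\<close> costs a whole unit at \<open>d = m\<close>,
  which leaves the fractional part near 0, but only the fraction \<open>sqrt d / sqrt m\<close> of a
  unit at smaller \<open>d\<close>.\<close>

lemma simultaneous_fractional_parts:
  fixes m D N :: nat and R :: real
  assumes "m \<ge> 1" "m \<le> D" "2 * sqrt (real m) \<le> real N"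
  defines "\<epsilon> \<equiv> 1 / real N"
  obtains \<alpha> where "\<alpha> > R" "frac (\<alpha> * sqrt (real m)) < 2 * \<epsilon>"
    "\<And>d. 1 \<le> d \<Longrightarrow> d \<le> D \<Longrightarrow> 2 * sqrt (real d) < sqrt (real m) \<Longrightarrow>
       \<bar>frac (\<alpha> * sqrt (real d)) - (1 - sqrt (real d) / sqrt (real m))\<bar> \<le> 2 * \<epsilon>"
proof -
  define M where "M = sqrt (real m)"
  have M: "M \<ge> 1" using assms(1) by (simp add: M_def)
  have N0: "real N > 0" using assms(3) M unfolding M_def by linarith
  then have "N > 0" by simp
  have \<epsilon>: "0 < \<epsilon>" "2 * \<epsilon> * M \<le> 1" "2 * \<epsilon> \<le> 1"
  proof -
    show "0 < \<epsilon>" using N0 by (simp add: \<epsilon>_def)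
    show "2 * \<epsilon> * M \<le> 1" using assms(3) N0 by (simp add: \<epsilon>_def M_def field_simps)
    then show "2 * \<epsilon> \<le> 1" using M \<open>0 < \<epsilon>\<close>
      by (metis dual_order.trans less_imp_le mult.right_neutral mult_left_mono mult_pos_pos zero_less_numeral)
  qed
  \<comment> \<open>The multiplier \<open>k\<close> from Dirichlet's theorem may be as small as 1,
    so the approximation is applied to multiples of a large \<open>t\<close> to force
    \<open>T\<close> to be large.\<close>
  obtain t :: nat where t: "max R 0 + 2 < real t" using reals_Archimedean2 by blast
  obtain k z where k: "0 < k"
    and z: "\<And>i. i < Suc D \<Longrightarrow> \<bar>real_of_int k * (real t * sqrt (real i)) - real_of_int (z i)\<bar> < 1 / real N"
    using Dirichlet_approx_simult[OF \<open>N > 0\<close>, of "Suc D" "\<lambda>i. real t * sqrt (real i)"] by blast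
  define T where "T = real_of_int k * real t"
  \<comment> \<open>The shift by \<open>\<epsilon> / M\<close> makes \<open>\<alpha> M\<close> land above the integer despite the approximation error.\<close>
  define \<alpha> where "\<alpha> = T - 1 / M + \<epsilon> / M"
  define e where "e d = T * sqrt (real d) - real_of_int (z d)" for d
  have e: "\<bar>e d\<bar> < \<epsilon>" if "d \<le> D" for d
    using z[of d] that by (simp add: e_def T_def \<epsilon>_def mult.assoc)
  have rep: "\<alpha> * sqrt (real d) = real_of_int (z d) + (e d - sqrt (real d) / M + \<epsilon> * (sqrt (real d) / M))" for d
    by (simp add: \<alpha>_def e_def algebra_simps)
  show thesis
  proof
    have "real t \<le> T" unfolding T_def using k t by (simp add: mult_le_cancel_right1)
    moreover have "1 / M \<le> 1" "0 \<le> \<epsilon> / M" using M \<epsilon> by auto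
    ultimately show "\<alpha> > R" using t by (simp add: \<alpha>_def)
    have "\<alpha> * sqrt (real m) - (e m + \<epsilon>) = real_of_int (z m - 1)"
      using M rep[of m] by (simp flip: M_def)
    then have "\<alpha> * sqrt (real m) - (e m + \<epsilon>) \<in> \<int>" by (metis Ints_of_int)
    then have "frac (\<alpha> * sqrt (real m)) = e m + \<epsilon>"
      using e[OF assms(2)] \<epsilon> by (subst frac_unique_iff) auto
    then show "frac (\<alpha> * sqrt (real m)) < 2 * \<epsilon>" using e[OF assms(2)] by auto
  next
    fix d assume d: "1 \<le> d" "d \<le> D" "2 * sqrt (real d) < sqrt (real m)"
    define r where "r = sqrt (real d) / M"
    have r: "r < 1/2" "1 / M \<le> r"
      using d M by (auto simp: r_def M_def divide_less_eq intro: divide_right_mono)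
    have "2 * \<epsilon> \<le> 1 / M" using \<epsilon>(2) M by (simp add: field_simps)
    with r have r': "2 * \<epsilon> \<le> r" by linarith
    have er: "\<epsilon> * r \<le> \<epsilon> * (1/2)" "0 \<le> \<epsilon> * r" using \<epsilon> r r' by (intro mult_left_mono mult_nonneg_nonneg; simp)+
    have "\<alpha> * sqrt (real d) - (1 + e d - r + \<epsilon> * r) = real_of_int (z d - 1)"
      unfolding rep r_def[symmetric] by simp
    then have "\<alpha> * sqrt (real d) - (1 + e d - r + \<epsilon> * r) \<in> \<int>" by (metis Ints_of_int)
    \<comment> \<open>Since \<open>2 * \<epsilon> \<le> r < 1/2\<close>, the errors cannot push the
      value across an integer.\<close>
    moreover have "0 \<le> 1 + e d - r + \<epsilon> * r" "1 + e d - r + \<epsilon> * r < 1"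
      using e[OF d(2)] \<epsilon>(1,3) r r' er by linarith+
    ultimately have "frac (\<alpha> * sqrt (real d)) = 1 + e d - r + \<epsilon> * r"
      by (simp only: frac_unique_iff)
    then show "\<bar>frac (\<alpha> * sqrt (real d)) - (1 - sqrt (real d) / sqrt (real m))\<bar> \<le> 2 * \<epsilon>"
      unfolding M_def[symmetric] r_def[symmetric] using e[OF d(2)] er \<epsilon>(1) by linarith
  qed
qed

section \<open>Numerical comparison of the gains\<close>

lemma sqrt_consecutive_bounds:
  fixes n :: nat
  assumes "n \<ge> 1"
  defines "M \<equiv> sqrt (real n * real (n + 1))"
  shows "1 \<le> M" "M \<le> real n + 1/2" "2 * (M - real n) \<ge> 1 - 1 / (4 * real n + 1)"
proof -
  have MM: "M * M = real n * (real n + 1)" by (simp add: M_def)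
  have n: "real n \<ge> 1" using assms by simp
  have "real n * (real n + 1) \<ge> 1 * 1" using n by (intro mult_mono) auto
  then show "1 \<le> M" by (simp add: M_def add.commute)
  show M: "M \<le> real n + 1/2"
    unfolding M_def by (rule real_le_lsqrt) (auto simp: power2_eq_square algebra_simps)
  \<comment> \<open>\<open>M - n\<close> equals \<open>n / (M + n)\<close>, and the denominator is
    at most \<open>2 * n + 1/2\<close>.\<close>
  have "(M - real n) * (2 * real n + 1/2) \<ge> (M - real n) * (M + real n)"
  proof (rule mult_left_mono)
    have "real n \<le> M" unfolding M_def by (rule real_le_rsqrt) (simp add: power2_eq_square algebra_simps)
    then show "0 \<le> M - real n" by simp
  qed (use M in simp)
  also have "(M - real n) * (M + real n) = real n" using MM by (simp add: algebra_simps)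
  finally have "real n \<le> (M - real n) * (2 * real n + 1/2)" .
  then show "2 * (M - real n) \<ge> 1 - 1 / (4 * real n + 1)" using n by (simp add: field_simps)
qed

text \<open>Up to small errors, a tilted slope gains \<open>x * (1 - x) / (2 * s)\<close> per unit
  of \<open>\<alpha>\<close>, and \<open>(n + 1) / n\<close> gains \<open>1 - n / M\<close>. With
  \<open>r = s / M\<close>, multiplication by \<open>2 * s\<close> compares
  \<open>x * (1 - x)\<close> with \<open>2 * r * (M - n)\<close>. For \<open>r \<ge> 1/2\<close>
  this is 1/4 against 2/5. For \<open>r < 1/2\<close> closeness gives about
  \<open>r - r\<^sup>2\<close> against \<open>r - r / (4 * n + 1)\<close>, and
  \<open>r \<ge> 1 / E\<close> decides.\<close>

lemma tilted_gain_less: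
  fixes n :: nat and s H x :: real
  assumes n: "n \<ge> 1"
  defines "E \<equiv> real n + 1" and "M \<equiv> sqrt (real n * real (n + 1))"
  defines "\<epsilon> \<equiv> 1 / (20 * E\<^sup>2)"
  assumes s: "1 \<le> s" "s \<le> 500 * E" and H: "0 \<le> H" "H \<le> 1 / (10^4 * E^3)"
    and x: "0 \<le> x" "x \<le> 1" and close: "2 * s < M \<Longrightarrow> \<bar>x - (1 - s / M)\<bar> \<le> 2 * \<epsilon>"
  shows "(1 + 16 * H) * (x * (1 - x) + 8 * H) / (2 * s) \<le> 1 - (real n + 2 * \<epsilon>) / M - 1 / (10^5 * E^3)"
proof -
  have n1: "real n \<ge> 1" using n by simp
  have E: "E \<ge> 2" using n1 by (simp add: E_def)
  note M = sqrt_consecutive_bounds[OF n, folded M_def]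
  \<comment> \<open>The common unit for all error terms; the margin in the harder case
    \<open>r < 1/2\<close> is \<open>3/5 * w\<close>.\<close>
  define w where "w = 1 / E\<^sup>2"
  define r where "r = s / M"
  have "2^2 \<le> E\<^sup>2" using E by (intro power_mono) auto
  then have w: "0 < w" "w \<le> 1/4" using E by (auto simp: w_def field_simps)
  have w': "w = 1 / E * (1 / E)" by (simp add: w_def power2_eq_square)
  have \<epsilon>: "\<epsilon> = w / 20" by (simp add: \<epsilon>_def w_def)
  have Hw: "H \<le> w / 20000"
  proof -
    have "1 / (10^4 * E^3) = w / (10^4 * E)" by (simp add: w_def power2_eq_square power3_eq_cube)
    also have "\<dots> \<le> w / 20000" using w E by (intro divide_left_mono) auto
    finally show ?thesis using H by linarith
  qed
  have \<delta>: "2 * s * (1 / (10^5 * E^3)) \<le> w / 100"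
  proof -
    have "2 * s * (1 / (10^5 * E^3)) \<le> 2 * (500 * E) * (1 / (10^5 * E^3))"
      using s E by (intro mult_right_mono) auto
    also have "\<dots> = w / 100" using E by (simp add: w_def field_simps power2_eq_square power3_eq_cube)
    finally show ?thesis .
  qed
  define X where "X = x * (1 - x)"
  have X: "0 \<le> X" "X \<le> 1/4"
  proof -
    show "0 \<le> X" using x by (simp add: X_def)
    show "X \<le> 1/4" using zero_le_power2[of "x - 1/2"] by (simp add: X_def power2_eq_square algebra_simps)
  qed
  have "(1 + 16 * H) * (X + 8 * H) \<le> X + 13 * H"
  proof -
    have "H * X \<le> H * (1/4)" "H * H \<le> H * (1/128)"
      using H X Hw w by (intro mult_left_mono; linarith)+
    then show ?thesis by (simp add: algebra_simps)
  qed
  moreover have "X + 13 * H \<le> 2 * r * (M - real n - 2 * \<epsilon>) - w / 100"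
  proof (cases "2 * s < M")
    case False
    then have r: "1/2 \<le> r" using M by (simp add: r_def field_simps)
    have "1 / (4 * real n + 1) \<le> 1 / 5" using n1 by (simp add: field_simps)
    then have g: "2/5 - w / 10 \<le> M - real n - 2 * \<epsilon>" using M(3) unfolding \<epsilon> by argo
    also have "\<dots> \<le> 2 * r * (M - real n - 2 * \<epsilon>)"
      using r g w mult_right_mono[of 1 "2 * r" "M - real n - 2 * \<epsilon>"] by simp
    finally have "2/5 - w / 10 \<le> 2 * r * (M - real n - 2 * \<epsilon>)" .
    moreover have "X + 13 * H \<le> 2/5 - w / 10 - w / 100" using X Hw w by linarith
    ultimately show ?thesis by (meson diff_right_mono order_trans)
  next
    case True
    then have r: "r < 1/2" using M by (simp add: r_def field_simps)
    have rE: "1 / E \<le> r"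
      unfolding r_def using M s by (intro frac_le) (auto simp: E_def)
    have r0: "0 < r" using s M by (simp add: r_def)
    have "\<bar>x - (1 - r)\<bar> \<le> 2 * \<epsilon>" using close[OF True] by (simp add: r_def)
    moreover have "\<bar>r - x\<bar> \<le> 1" using r r0 x by auto
    ultimately have "\<bar>x - (1 - r)\<bar> * \<bar>r - x\<bar> \<le> 2 * \<epsilon> * 1"
      by (intro mult_mono) auto
    moreover have "X - r * (1 - r) = (x - (1 - r)) * (r - x)" by (simp add: X_def algebra_simps)
    ultimately have X2: "X \<le> r * (1 - r) + 2 * \<epsilon>" using abs_mult[of "x - (1 - r)" "r - x"] by linarith
    \<comment> \<open>Equality holds at \<open>n = 1\<close>.\<close>
    have "1 / (4 * real n + 1) \<le> 2 / 5 * (1 / E)" using n1 by (simp add: E_def field_simps)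
    then have "r - 1 / (4 * real n + 1) \<ge> 3 / 5 * (1 / E)" using rE by linarith
    then have "r * (r - 1 / (4 * real n + 1)) \<ge> 1 / E * (3 / 5 * (1 / E))"
      using rE E r0 by (intro mult_mono) auto
    then have rr: "r * r - r * (1 / (4 * real n + 1)) \<ge> 3 / 5 * w"
      unfolding w' by (simp add: algebra_simps)
    have "r * (1 - 1 / (4 * real n + 1)) \<le> r * (2 * (M - real n))"
      using r0 M by (intro mult_left_mono) auto
    moreover have "4 * \<epsilon> * r \<le> 4 * \<epsilon> * (1/2)"
      using r w by (intro mult_left_mono) (auto simp: \<epsilon>)
    ultimately have "2 * r * (M - real n - 2 * \<epsilon>) \<ge> r - r * (1 / (4 * real n + 1)) - w / 10"
      by (simp add: \<epsilon> algebra_simps)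
    moreover have "X \<le> r - r * r + w / 10" using X2 by (simp add: \<epsilon> algebra_simps)
    ultimately show ?thesis using rr Hw w by linarith
  qed
  ultimately have "(1 + 16 * H) * (X + 8 * H) \<le> 2 * r * (M - real n - 2 * \<epsilon>) - 2 * s * (1 / (10^5 * E^3))"
    using \<delta> by linarith
  also have "\<dots> = (1 - (real n + 2 * \<epsilon>) / M - 1 / (10^5 * E^3)) * (2 * s)"
    using M(1) by (simp add: r_def field_simps)
  finally show ?thesis using s by (simp add: X_def pos_divide_le_eq)
qed

text \<open>The instance \<open>s = M\<close>, \<open>x = 1/2\<close>, \<open>H = 0\<close> of the
  preceding comparison, where the closeness hypothesis is vacuous.\<close>

lemma gain_lower:
  fixes n :: nat
  assumes n: "n \<ge> 1"
  defines "E \<equiv> real n + 1" and "M \<equiv> sqrt (real n * real (n + 1))"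
  defines "\<epsilon> \<equiv> 1 / (20 * E\<^sup>2)"
  shows "1 / (8 * E) \<le> 1 - (real n + 2 * \<epsilon>) / M - 1 / (10^5 * E^3)"
proof -
  note M = sqrt_consecutive_bounds[OF n, folded M_def]
  have "1 / (8 * E) \<le> (1 + 16 * 0) * (1/2 * (1 - 1/2) + 8 * 0) / (2 * M)"
    using M(1,2) by (simp add: E_def field_simps)
  also have "\<dots> \<le> 1 - (real n + 2 * \<epsilon>) / M - 1 / (10^5 * E^3)"
    unfolding M_def E_def \<epsilon>_def
    by (rule tilted_gain_less[OF n]) (use M[unfolded M_def] in auto)
  finally show ?thesis .
qed

section \<open>Optimal slopes\<close>

text \<open>If \<open>a < 1\<close> there are no points, and \<open>\<alpha> \<ge> 3\<close> makes
  the bound nonnegative. Otherwise \<open>\<beta> \<le> a * \<beta>\<close>, so the loss is at least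
  \<open>3/8 * a * \<beta>\<close>, where
  \<open>a * \<beta> = \<alpha> * sqrt \<beta> \<ge> 4 * \<alpha>\<close>.\<close>

lemma lattice_count_steep:
  fixes \<alpha> \<beta> :: real
  assumes "\<alpha> \<ge> 3" "\<beta> \<ge> 16"
  shows "real (lattice_count \<beta> \<alpha>) \<le> \<alpha>\<^sup>2 / 2 - 3 / 2 * \<alpha>"
proof -
  define a where "a = \<alpha> / sqrt \<beta>"
  have \<alpha>\<beta>: "\<alpha> > 0" "\<beta> > 0" using assms by auto
  note ab = intercept_bounds[OF \<alpha>\<beta> a_def]
  show ?thesis
  proof (cases "a < 1")
    case True
    then have "nat \<lfloor>a\<rfloor> = 0" using ab(1) by (simp add: floor_eq_iff)
    then have "real (lattice_count \<beta> \<alpha>) = 0" using lattice_count_eq_sum[OF \<alpha>\<beta> a_def] by simp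
    moreover have "3 * \<alpha> \<le> \<alpha> * \<alpha>" using assms by (intro mult_right_mono) auto
    ultimately show ?thesis by (simp add: power2_eq_square)
  next
    case False
    have "4 \<le> sqrt \<beta>" using assms by (intro real_le_rsqrt) simp
    then have "\<alpha> * 4 \<le> a * \<beta>" unfolding ab(2) using assms by (intro mult_left_mono) auto
    moreover have "1 * \<beta> \<le> a * \<beta>" using False \<alpha>\<beta> by (intro mult_right_mono) auto
    moreover have "real (lattice_count \<beta> \<alpha>) \<le> \<alpha>\<^sup>2 / 2 - a * \<beta> / 2 + \<beta> / 8 - 0"
      by (rule lattice_count_le_sum[OF \<alpha>\<beta> a_def]) (simp add: sum_nonneg)
    ultimately show ?thesis by linarith
  qed
qed

text \<open>Dirichlet's theorem supplies \<open>p / q\<close> near \<open>\<beta>\<close> with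
  \<open>q \<le> Q\<close>. The first alternative puts the count below what
  \<open>(n + 1) / n\<close> is sure to reach. The value of \<open>Q\<close> makes
  \<open>H \<le> 1 / (10^4 * E^3)\<close> for \<open>q \<le> 100 * E\<close>, and the size of
  \<open>\<alpha>\<close> lets the slack \<open>\<delta> * \<alpha>\<close> absorb all bounded
  terms.\<close>

lemma dominated_by_rational_slope:
  fixes n Q :: nat and \<alpha> \<beta> :: real
  assumes n: "n \<ge> 1" and Q: "Q = 10^6 * (n + 1)^4"
  defines "E \<equiv> real n + 1" and "M \<equiv> sqrt (real n * real (n + 1))"
  defines "\<epsilon> \<equiv> 1 / (20 * E\<^sup>2)"
  assumes \<alpha>: "10^5 * E^3 * (2 * real Q + 2 * real n + 8) \<le> \<alpha>"
    and close: "\<And>d. 1 \<le> d \<Longrightarrow> d \<le> (17 * Q)\<^sup>2 \<Longrightarrow> 2 * sqrt (real d) < M \<Longrightarrow>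
       \<bar>frac (\<alpha> * sqrt (real d)) - (1 - sqrt (real d) / M)\<bar> \<le> 2 * \<epsilon>"
    and \<beta>: "\<beta> > 0"
  shows "real (lattice_count \<beta> \<alpha>) < \<alpha>\<^sup>2 / 2 - \<alpha> * ((real n + 2 * \<epsilon>) / M) - (2 * real n + 1) \<or>
    (\<exists>p\<in>{1..17*Q}. \<exists>q\<in>{1..17*Q}. lattice_count \<beta> \<alpha> \<le> lattice_count (real p / real q) \<alpha>)"
proof -
  define \<delta> G where "\<delta> = 1 / (10^5 * E^3)" and "G = 1 - (real n + 2 * \<epsilon>) / M - \<delta>"
  define L where "L = \<alpha>\<^sup>2 / 2 - \<alpha> * ((real n + 2 * \<epsilon>) / M) - (2 * real n + 1)"
  have E: "E \<ge> 2" using n by (simp add: E_def)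
  have Q': "real Q = 10^6 * E^4" unfolding Q E_def by (simp add: add.commute)
  have "1 \<le> E^4" using E by (intro one_le_power) auto
  then have Q16: "real Q \<ge> 10^6" by (simp add: Q')
  have G: "1 / (8 * E) \<le> G"
    unfolding G_def \<delta>_def E_def M_def \<epsilon>_def by (rule gain_lower[OF n])
  then have "0 \<le> G" using E by (meson divide_nonneg_pos le_numeral_extra(2) mult_pos_pos order_trans zero_le_one zero_less_numeral less_le_trans)
  have \<delta>\<alpha>: "2 * real Q + 2 * real n + 8 \<le> \<delta> * \<alpha>"
    using \<alpha> E by (simp add: \<delta>_def field_simps)
  have \<alpha>3: "\<alpha> \<ge> 3"
  proof -
    have "1 \<le> E^3" using E by (intro one_le_power) auto
    then have "1 \<le> 10^5 * E^3" by simp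
    with E have "1 * 8 \<le> 10^5 * E^3 * (2 * real Q + 2 * real n + 8)" by (intro mult_mono) auto
    then show ?thesis using \<alpha> by linarith
  qed
  have Leq: "L = \<alpha>\<^sup>2 / 2 - \<alpha> + \<alpha> * G + \<delta> * \<alpha> - (2 * real n + 1)"
    by (simp add: L_def G_def algebra_simps)
  have "0 \<le> \<alpha> * G" using \<alpha>3 \<open>0 \<le> G\<close> by simp
  have steep: "real (lattice_count b \<alpha>) < L" if "b \<ge> 16" for b
    using lattice_count_steep[OF \<alpha>3 that] Leq \<delta>\<alpha> \<open>0 \<le> \<alpha> * G\<close> \<alpha>3 by linarith
  consider "\<beta> \<ge> 16" | "1 / \<beta> \<ge> 16" | "1/16 \<le> \<beta>" "\<beta> \<le> 16"
    using \<beta> by (fastforce simp: field_simps)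
  then have "real (lattice_count \<beta> \<alpha>) < L \<or>
    (\<exists>p\<in>{1..17*Q}. \<exists>q\<in>{1..17*Q}. lattice_count \<beta> \<alpha> \<le> lattice_count (real p / real q) \<alpha>)"
  proof cases
    case 1
    then show ?thesis using steep by blast
  next
    case 2
    then show ?thesis using steep[OF 2] lattice_count_inverse[OF \<beta>] by simp
  next
    case 3
    have "Q > 0" using Q by simp
    from Dirichlet_approx_coprime[OF this, of \<beta>]
    obtain h k where hk: "coprime h k" "0 < k" "k \<le> int Q" "\<bar>real_of_int k * \<beta> - real_of_int h\<bar> < 1 / real Q"
      by blast
    define p q where "p = nat h" and "q = nat k"
    have "1 / real Q \<le> 1 / 10^6" using Q16 by (intro divide_left_mono) auto
    then have hk': "\<bar>real_of_int k * \<beta> - real_of_int h\<bar> < 1/100" using hk(4) by simp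
    \<comment> \<open>The numerator is positive because \<open>k * \<beta> \<ge> 1/16\<close>
      exceeds the approximation error, and it is at most \<open>16 * k + 1 \<le> 17 * k\<close>, the
      origin of the bound \<open>17 * Q\<close>.\<close>
    have "1 * (1/16) \<le> real_of_int k * \<beta>" "real_of_int k * \<beta> \<le> real_of_int k * 16"
      using hk(2) 3 by (intro mult_mono; simp)+
    with hk' have h: "0 < real_of_int h" and "real_of_int h < real_of_int k * 16 + 1" by linarith+
    then have "real_of_int h < real_of_int (16 * k + 1)" by simp
    with h have h': "0 < h" "h \<le> 17 * k" using hk(2) by linarith+
    have pq: "int p = h" "int q = k" using h' hk(2) by (auto simp: p_def q_def)
    have pq': "real_of_int h = real p" "real_of_int k = real q" using pq by (metis of_int_of_nat_eq)+
    have p: "p > 0" "p \<le> 17 * q" and q: "q > 0" "q \<le> Q" using pq h' hk(2,3) by linarith+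
    have cop: "coprime p q" using hk(1) by (simp flip: pq)
    define H where "H = real q * \<bar>real q * \<beta> - real p\<bar>"
    have HQ: "0 \<le> H" "H \<le> real q / real Q"
      using mult_left_mono[OF less_imp_le[OF hk(4)], of "real q"] by (simp_all add: H_def pq')
    define a where "a = \<alpha> / sqrt \<beta>"
    have \<alpha>0: "\<alpha> > 0" using \<alpha>3 by simp
    note ab = intercept_bounds[OF \<alpha>0 \<beta> a_def]
    have mem: "p \<in> {1..17*Q}" "q \<in> {1..17*Q}" using p q by auto
    have less: "real (lattice_count \<beta> \<alpha>) < L"
      if "real (lattice_count \<beta> \<alpha>) \<le> \<alpha>\<^sup>2 / 2 - \<alpha> + \<alpha> * G + real q + 6"
      using that Leq \<delta>\<alpha> q(2)[folded of_nat_le_iff[where 'a = real]] by linarith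
    show ?thesis
    \<comment> \<open>Below the threshold the tilt estimate applies; above it the crude bound for
      large denominators suffices, since \<open>a \<le> 4 * \<alpha>\<close> gives at most
      \<open>6/100 * \<alpha> / E\<close>, less than the gain
      \<open>\<alpha> / (8 * E)\<close>.\<close>
    proof (cases "q < 100 * (n + 1)")
      case True
      then have qE: "real q \<le> 100 * E"
        using of_nat_less_iff[of q "100 * (n + 1)", where 'a = real] by (simp add: E_def)
      have HE: "H \<le> 1 / (10^4 * E^3)"
      proof -
        have "real q / real Q \<le> 100 * E / real Q" using qE by (intro divide_right_mono) auto
        also have "\<dots> = 1 / (10^4 * E^3)" using E by (simp add: Q' field_simps power_numeral_reduce)
        finally show ?thesis using HQ by simp
      qed
      define s where "s = sqrt (real p * real q)"
      define x where "x = frac (\<alpha> * s)"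
      have sd: "s = sqrt (real (p * q))" by (simp add: s_def)
      have "1 \<le> p * q" using p q by simp
      then have s1: "1 \<le> s" unfolding sd by (metis of_nat_1 of_nat_le_iff real_sqrt_ge_1_iff)
      have "real p * real q \<le> 17 * real q * real q" using p by (intro mult_right_mono) auto
      also have "\<dots> \<le> (5 * real q)\<^sup>2" by (simp add: power2_eq_square)
      finally have "s \<le> 5 * real q" unfolding s_def by (intro real_le_lsqrt) auto
      then have s2: "s \<le> 500 * E" using qE by linarith
      have "p * q \<le> (17 * Q) * (17 * Q)" using mem by (intro mult_le_mono) auto
      then have xc: "\<bar>x - (1 - s / M)\<bar> \<le> 2 * \<epsilon>" if "2 * s < M"
        using close[of "p * q"] \<open>1 \<le> p * q\<close> that by (simp add: sd x_def power2_eq_square)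
      have x: "0 \<le> x" "x \<le> 1" by (simp_all add: x_def frac_lt_1 less_imp_le)
      have gain: "(1 + 16 * H) * (x * (1 - x) + 8 * H) / (2 * s) \<le> G"
        unfolding G_def \<delta>_def E_def M_def \<epsilon>_def
        by (rule tilted_gain_less[OF n s1 _ HQ(1) _ x])
           (use s2 HE xc in \<open>simp_all only: E_def M_def \<epsilon>_def\<close>)
      \<comment> \<open>\<open>s\<^sup>2\<close> exceeds \<open>q\<^sup>2 * \<beta>\<close> by at
        most \<open>H\<close>. As \<open>q\<^sup>2 * \<beta> \<ge> 1/16\<close>, this is a relative
        excess of at most \<open>16 * H\<close>.\<close>
      have as: "a / (2 * real q) \<le> \<alpha> * (1 + 16 * H) / (2 * s)"
      proof -
        have q\<beta>: "1 * (1/16) \<le> (real q * real q) * \<beta>"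
        proof (rule mult_mono)
          have "1 \<le> q * q" using q by simp
          then show "1 \<le> real q * real q" by (metis of_nat_1 of_nat_le_iff of_nat_mult)
        qed (use 3 in auto)
        have "s\<^sup>2 = real q * real p" by (simp add: s_def)
        also have "\<dots> \<le> real q * (real q * \<beta> + \<bar>real q * \<beta> - real p\<bar>)"
          by (intro mult_left_mono) auto
        also have "\<dots> = (real q * real q) * \<beta> + H" by (simp add: H_def algebra_simps)
        also have "\<dots> \<le> (real q * real q) * \<beta> + 16 * ((real q * real q) * \<beta>) * H"
          using mult_right_mono[OF q\<beta> HQ(1)] by simp
        also have "\<dots> = ((real q * real q) * \<beta>) * (1 + 16 * H)" by (simp add: algebra_simps)
        also have "\<dots> \<le> ((real q * real q) * \<beta>) * (1 + 16 * H)\<^sup>2"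
          using q\<beta> HQ(1) by (intro mult_left_mono) (auto simp: power2_eq_square algebra_simps)
        also have "\<dots> = (real q * sqrt \<beta> * (1 + 16 * H))\<^sup>2"
          using \<beta> by (simp add: power_mult_distrib power2_eq_square)
        finally have "s \<le> real q * sqrt \<beta> * (1 + 16 * H)"
          by (rule power2_le_imp_le) (use \<beta> HQ(1) in auto)
        then have "a * s \<le> a * (real q * sqrt \<beta> * (1 + 16 * H))"
          using ab(1) by (intro mult_left_mono) auto
        also have "\<dots> = \<alpha> * (1 + 16 * H) * real q" by (simp add: ab(3)[symmetric] mult_ac)
        finally show ?thesis using s1 q by (simp add: field_simps)
      qed
      have "a / (2 * real q) * (x * (1 - x) + 8 * H) \<le> \<alpha> * (1 + 16 * H) / (2 * s) * (x * (1 - x) + 8 * H)"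
        using as x HQ(1) by (intro mult_right_mono) auto
      also have "\<dots> = \<alpha> * ((1 + 16 * H) * (x * (1 - x) + 8 * H) / (2 * s))" by simp
      also have "\<dots> \<le> \<alpha> * G" using gain \<alpha>0 by (intro mult_left_mono) auto
      finally have bound: "a / (2 * real q) * (x * (1 - x) + 8 * H) \<le> \<alpha> * G" .
      from lattice_count_le_or_upper[OF \<alpha>0 \<beta> 3(2) p(1) q(1) cop a_def, folded s_def x_def H_def]
      show ?thesis
      proof
        assume "lattice_count \<beta> \<alpha> \<le> lattice_count (real p / real q) \<alpha>"
        then show ?thesis using mem by blast
      next
        assume "real (lattice_count \<beta> \<alpha>) \<le> \<alpha>\<^sup>2 / 2 - \<alpha> + a / (2 * real q) * (x * (1 - x) + 8 * H) + real q + 6"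
        with bound have "real (lattice_count \<beta> \<alpha>) < L" by (intro less) linarith
        then show ?thesis ..
      qed
    next
      case False
      then have qE: "100 * E \<le> real q"
        using of_nat_le_iff[of "100 * (n + 1)" q, where 'a = real] by (simp add: E_def)
      have "real q / real Q \<le> 1" using q by simp
      then have "H \<le> 1" using HQ(2) by linarith
      have "1/4 \<le> sqrt \<beta>" using 3 by (intro real_le_rsqrt) (simp add: power2_eq_square)
      then have "a * (1/4) \<le> \<alpha>" unfolding ab(3)[symmetric] using ab(1) by (intro mult_left_mono) auto
      then have "3 * a \<le> 12 * \<alpha>" by simp
      then have "3 * a / (2 * real q) \<le> 12 * \<alpha> / (2 * (100 * E))"
        using qE E ab(1) \<alpha>0 by (intro frac_le) auto
      also have "\<dots> \<le> \<alpha> * (1 / (8 * E))" using E \<alpha>0 by (simp add: field_simps)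
      also have "\<dots> \<le> \<alpha> * G" using G \<alpha>0 by (intro mult_left_mono) auto
      finally have bound: "3 * a / (2 * real q) \<le> \<alpha> * G" .
      have "real (lattice_count \<beta> \<alpha>) < L"
        using lattice_count_le_large_denominator[OF \<alpha>0 \<beta> 3(2) q(1) cop a_def] \<open>H \<le> 1\<close> bound
        unfolding H_def by (intro less) linarith
      then show ?thesis ..
    qed
  qed
  then show ?thesis by (simp only: L_def)
qed

text \<open>\<open>2 * s \<le> p + q\<close> by the inequality of the means, and a fractional part
  of at least 1/2 compensates the \<open>- 1\<close> in the coefficient of
  \<open>\<alpha>\<close>.\<close>

lemma lattice_count_small_slope:
  fixes \<alpha> :: real and p q :: nat
  assumes "\<alpha> > 0" "p > 0" "q > 0" "coprime p q" "1/2 \<le> frac (\<alpha> * sqrt (real p * real q))"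
  shows "real (lattice_count (real p / real q) \<alpha>) \<le> \<alpha>\<^sup>2 / 2 - \<alpha> + real p + real q"
proof -
  define s where "s = sqrt (real p * real q)"
  have "s > 0" using assms by (simp add: s_def)
  have "2 * s \<le> real p + real q"
    using arith_geo_mean_sqrt[of "real p" "real q"] by (simp add: s_def)
  then have "2 * s \<le> real p + real q - 1 + 2 * frac (\<alpha> * s)"
    using assms(5) unfolding s_def by linarith
  then have "1 \<le> (real p + real q - 1 + 2 * frac (\<alpha> * s)) / (2 * s)"
    using \<open>s > 0\<close> by simp
  then have "\<alpha> * 1 \<le> \<alpha> * ((real p + real q - 1 + 2 * frac (\<alpha> * s)) / (2 * s))"
    using assms(1) by (intro mult_left_mono) auto
  then show ?thesis
    using lattice_count_rational_approx[OF assms(1-4)] unfolding s_def by (simp add: abs_le_iff)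
qed

lemma Limsup_gt_if_frequently:
  fixes f :: "'a \<Rightarrow> real"
  assumes "\<exists>\<^sub>F x in F. c \<le> f x" "b < c"
  shows "Limsup F (\<lambda>x. ereal (f x)) > ereal b"
proof (rule ccontr)
  assume "\<not> ?thesis"
  then have "Limsup F (\<lambda>x. ereal (f x)) < ereal c"
    using assms(2) by (meson ereal_less_eq(3) less_ereal.simps(1) not_less order_le_less_trans)
  then have "\<forall>\<^sub>F x in F. ereal (f x) < ereal c" by (rule Limsup_lessD)
  then have "\<forall>\<^sub>F x in F. \<not> c \<le> f x" by (rule eventually_mono) simp
  with assms(1) show False by (simp add: frequently_def)
qed

text \<open>The candidates \<open>Z\<close> depend on \<open>n\<close> only, so one of them
  satisfies \<open>P\<close> for arbitrarily large \<open>\<alpha>\<close>. The clauses of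
  \<open>P\<close> give, in turn, membership in \<open>S_set\<close>, membership in
  \<open>Lambda_set\<close>, and distinctness from every \<open>small\<close> slope.\<close>

lemma exists_optimal_slope_avoiding_small:
  fixes n :: nat
  assumes n: "n \<ge> 1"
  shows "\<exists>\<gamma>\<in>Lambda_set \<inter> S_set. \<forall>p q. 0 < p \<longrightarrow> 0 < q \<longrightarrow> coprime p q \<longrightarrow>
           16 * (p * q) \<le> n * (n + 1) \<longrightarrow> \<gamma> \<noteq> real p / real q"
proof -
  define E M where "E = real n + 1" and "M = sqrt (real n * real (n + 1))"
  define \<epsilon> \<delta> where "\<epsilon> = 1 / (20 * E\<^sup>2)" and "\<delta> = 1 / (10^5 * E^3)"
  define Q where "Q = 10^6 * (n + 1)^4"
  define \<kappa> where "\<kappa> = (real n + 2 * \<epsilon>) / M"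
  define L where "L \<alpha> = \<alpha>\<^sup>2 / 2 - \<alpha> * \<kappa> - (2 * real n + 1)" for \<alpha>
  define Z where "Z = {1..17*Q} \<times> {1..17*Q}"
  define f where "f g = real (fst g) / real (snd g)" for g :: "nat \<times> nat"
  define small where "small p q \<longleftrightarrow> 0 < p \<and> 0 < q \<and> coprime p q \<and> 16 * (p * q) \<le> n * (n + 1)" for p q :: nat
  define P where "P g \<alpha> \<longleftrightarrow> (\<forall>\<beta>>0. lattice_count \<beta> \<alpha> \<le> lattice_count (f g) \<alpha>) \<and>
      L \<alpha> \<le> real (lattice_count (f g) \<alpha>) \<and>
      (\<forall>p q. small p q \<longrightarrow> real (lattice_count (real p / real q) \<alpha>) < L \<alpha>)" for g \<alpha>
  note M = sqrt_consecutive_bounds[OF n, folded M_def]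
  have E: "E \<ge> 2" using n by (simp add: E_def)
  have \<delta>0: "\<delta> > 0" using E by (simp add: \<delta>_def)
  have "2^2 \<le> E\<^sup>2" using E by (intro power_mono) auto
  then have \<epsilon>: "0 < \<epsilon>" "\<epsilon> \<le> 1/80" using E by (auto simp: \<epsilon>_def field_simps)
  have gain: "1 / (8 * E) \<le> 1 - \<kappa> - \<delta>"
    unfolding \<kappa>_def \<delta>_def E_def M_def \<epsilon>_def by (rule gain_lower[OF n])
  have "0 < 1 / (8 * E)" using E by simp
  with gain have \<kappa>: "\<kappa> + \<delta> \<le> 1" by linarith
  have "(n + 1) * 1 \<le> (n + 1) * (n + 1)^3" by (intro mult_le_mono) auto
  then have nQ4: "n + 1 \<le> (n + 1)^4" by (simp add: power_numeral_reduce)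
  have "n * (n + 1) \<le> (n + 1) * (n + 1) * ((n + 1) * (n + 1))" by (simp add: algebra_simps)
  then have nnQ: "n * (n + 1) \<le> Q" by (simp add: Q_def power_numeral_reduce)
  have nQ: "n + 1 \<le> Q" using nQ4 by (simp add: Q_def)
  have "\<exists>\<^sub>F \<alpha> in at_top. \<exists>g\<in>Z. P g \<alpha>"
    unfolding frequently_def eventually_at_top_dense
  proof (clarsimp)
    fix R :: real
    define R' where "R' = max R (10^5 * E^3 * (2 * real Q + 2 * real n + 8))"
    let ?N = "20 * (n + 1)\<^sup>2"
    have Ms: "M = sqrt (real (n * (n + 1)))" by (simp only: M_def of_nat_mult)
    have \<epsilon>N: "\<epsilon> = 1 / real ?N" by (simp add: \<epsilon>_def E_def add.commute)
    have "2 * E \<le> 20 * E\<^sup>2" using E by (simp add: power2_eq_square)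
    then have MN: "2 * sqrt (real (n * (n + 1))) \<le> real ?N"
      unfolding Ms[symmetric] using M(2) by (simp add: E_def add.commute)
    have "1 \<le> n * (n + 1)" using n by simp
    moreover have "n * (n + 1) \<le> (17 * Q)\<^sup>2" using nnQ by (simp add: power2_eq_square) (metis le_square le_trans mult.commute mult_le_mono1 nat_mult_1 one_le_numeral)
    ultimately obtain \<alpha> where \<alpha>: "\<alpha> > R'" "frac (\<alpha> * M) < 2 * \<epsilon>"
      and close: "\<And>d. 1 \<le> d \<Longrightarrow> d \<le> (17 * Q)\<^sup>2 \<Longrightarrow> 2 * sqrt (real d) < M \<Longrightarrow>
         \<bar>frac (\<alpha> * sqrt (real d)) - (1 - sqrt (real d) / M)\<bar> \<le> 2 * \<epsilon>"
      using simultaneous_fractional_parts[OF _ _ MN, of "(17 * Q)\<^sup>2" R'] unfolding Ms[symmetric] \<epsilon>N[symmetric]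
      by metis
    have \<alpha>big: "10^5 * E^3 * (2 * real Q + 2 * real n + 8) \<le> \<alpha>" using \<alpha>(1) by (simp add: R'_def)
    have \<delta>\<alpha>: "2 * real Q + 2 * real n + 8 \<le> \<delta> * \<alpha>"
      using \<alpha>big E by (simp add: \<delta>_def field_simps)
    then have \<alpha>0: "\<alpha> > 0" using \<delta>0 by (smt (verit) mult_nonneg_nonpos of_nat_0_le_iff)
    \<comment> \<open>For \<open>p = n + 1\<close> and \<open>q = n\<close> the coefficient is
      \<open>(n + x) / M\<close> with \<open>x < 2 * \<epsilon>\<close>, and the error is at most
      \<open>p + q = 2 * n + 1\<close>; this explains the form of \<open>L\<close>.\<close>
    have c0: "L \<alpha> \<le> real (lattice_count (f (n + 1, n)) \<alpha>)"
    proof -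
      have s: "sqrt (real (n + 1) * real n) = M" by (simp add: M_def mult.commute)
      have "\<alpha> * (real (n + 1) + real n - 1 + 2 * frac (\<alpha> * M)) / (2 * M) = \<alpha> * ((real n + frac (\<alpha> * M)) / M)"
        using M(1) by (simp add: field_simps)
      also have "\<dots> \<le> \<alpha> * \<kappa>"
        unfolding \<kappa>_def using \<alpha> \<alpha>0 M(1) by (intro mult_left_mono divide_right_mono) auto
      finally show ?thesis
        using lattice_count_rational_approx[OF \<alpha>0, of "n + 1" n] n
        unfolding s by (simp add: f_def L_def abs_le_iff)
    qed
    have Z: "finite Z" "(n + 1, n) \<in> Z" using n nQ by (auto simp: Z_def)
    let ?c = "\<lambda>g. lattice_count (f g) \<alpha>"
    have "Max (?c ` Z) \<in> ?c ` Z" using Z by (intro Max_in) auto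
    then obtain g where g: "g \<in> Z" "?c g = Max (?c ` Z)" by auto
    have gmax: "?c g' \<le> ?c g" if "g' \<in> Z" for g'
      unfolding g(2) using Z(1) that by (intro Max_ge) auto
    have "P g \<alpha>"
      unfolding P_def
    proof (intro conjI allI impI)
      show Lg: "L \<alpha> \<le> real (?c g)" using c0 gmax[OF Z(2)] by linarith
      fix \<beta> :: real assume \<beta>: "\<beta> > 0"
      have "real (lattice_count \<beta> \<alpha>) < L \<alpha> \<or>
        (\<exists>p\<in>{1..17*Q}. \<exists>q\<in>{1..17*Q}. lattice_count \<beta> \<alpha> \<le> lattice_count (real p / real q) \<alpha>)"
        unfolding L_def \<kappa>_def \<epsilon>_def E_def M_def
        using \<alpha>big close
        by (intro dominated_by_rational_slope[OF n Q_def _ _ \<beta>]) (simp_all only: \<epsilon>_def E_def M_def)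
      then show "lattice_count \<beta> \<alpha> \<le> ?c g"
      proof (elim disjE bexE)
        fix p q assume pq: "p \<in> {1..17*Q}" "q \<in> {1..17*Q}" "lattice_count \<beta> \<alpha> \<le> lattice_count (real p / real q) \<alpha>"
        then show ?thesis using gmax[of "(p, q)"] by (simp add: Z_def f_def)
      qed (use Lg in linarith)
    next
      fix p q assume "small p q"
      then have pq: "0 < p" "0 < q" "coprime p q" "16 * (p * q) \<le> n * (n + 1)" by (auto simp: small_def)
      have s: "sqrt (real (p * q)) = sqrt (real p * real q)" by simp
      have "p * 1 \<le> p * q" "1 * q \<le> p * q" using pq by (intro mult_le_mono; simp)+
      then have "p \<le> Q" "q \<le> Q" using pq nnQ by linarith+
      have "16 * (real p * real q) \<le> real n * real (n + 1)"
        using pq(4) by (metis of_nat_le_iff of_nat_mult of_nat_numeral)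
      then have "sqrt (16 * (real p * real q)) \<le> M" unfolding M_def by (rule real_sqrt_le_mono)
      then have sM: "4 * sqrt (real p * real q) \<le> M" by (simp add: real_sqrt_mult)
      moreover have "0 < sqrt (real p * real q)" using pq by simp
      ultimately have "2 * sqrt (real (p * q)) < M" unfolding s by linarith
      moreover have "p * q \<le> (17 * Q)\<^sup>2"
        unfolding power2_eq_square using \<open>p \<le> Q\<close> \<open>q \<le> Q\<close> by (intro mult_le_mono) auto
      ultimately have "\<bar>frac (\<alpha> * sqrt (real p * real q)) - (1 - sqrt (real p * real q) / M)\<bar> \<le> 2 * \<epsilon>"
        using close[of "p * q"] pq unfolding s by (simp add: Suc_le_eq)
      \<comment> \<open>The fractional part is thus at least
        \<open>3/4 - 2 * \<epsilon>\<close>.\<close>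
      moreover have "sqrt (real p * real q) / M \<le> 1/4" using sM M(1) by (simp add: field_simps)
      ultimately have "1/2 \<le> frac (\<alpha> * sqrt (real p * real q))" using \<epsilon> by linarith
      then have "real (lattice_count (real p / real q) \<alpha>) \<le> \<alpha>\<^sup>2 / 2 - \<alpha> + real p + real q"
        by (rule lattice_count_small_slope[OF \<alpha>0 pq(1-3)])
      moreover have "real p \<le> real Q" "real q \<le> real Q" using \<open>p \<le> Q\<close> \<open>q \<le> Q\<close> by auto
      moreover have "\<alpha> * (\<kappa> + \<delta>) \<le> \<alpha> * 1" using \<kappa> \<alpha>0 by (intro mult_left_mono) auto
      ultimately show "real (lattice_count (real p / real q) \<alpha>) < L \<alpha>"
        using \<delta>\<alpha> by (simp add: L_def algebra_simps)
    qed
    then show "\<exists>\<alpha>>R. \<exists>g\<in>Z. P g \<alpha>" using \<alpha>(1) g(1) by (auto simp: R'_def)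
  qed
  then obtain g where g: "g \<in> Z" and freq: "\<exists>\<^sub>F \<alpha> in at_top. P g \<alpha>"
    using frequently_bex_finite[of Z "\<lambda>\<alpha> g. P g \<alpha>" at_top] by (auto simp: Z_def)
  have fg: "f g > 0" "f g \<in> \<rat>" using g by (auto simp: f_def Z_def)
  have ex: "\<exists>\<alpha>>r. P g \<alpha>" for r
    using freq unfolding frequently_def eventually_at_top_dense by blast
  have "f g \<in> S_set"
    unfolding S_set_def
  proof (intro INT_I)
    fix r :: real
    obtain \<alpha> where "\<alpha> > r" "P g \<alpha>" using ex by blast
    then show "f g \<in> (\<Union>\<alpha>\<in>{r<..}. optimal_slopes \<alpha>)"
      using fg by (auto simp: optimal_slopes_def is_arg_max_linorder P_def)
  qed
  moreover have "f g \<in> Lambda_set"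
  proof -
    \<comment> \<open>Beyond \<open>K\<close> the constant \<open>2 * n + 1\<close> in
      \<open>L\<close> is absorbed by \<open>\<delta> * \<alpha>\<close>, leaving the gain
      \<open>1 / (8 * E)\<close> above -1.\<close>
    define K where "K = (2 * real n + 1) / \<delta>"
    have "\<exists>\<^sub>F \<alpha> in at_top. -1 + 1 / (8 * E) \<le> (real (lattice_count (f g) \<alpha>) - \<alpha>\<^sup>2 / 2) / \<alpha>"
    proof (rule frequently_rev_mp[OF freq])
      show "\<forall>\<^sub>F \<alpha> in at_top. P g \<alpha> \<longrightarrow> -1 + 1 / (8 * E) \<le> (real (lattice_count (f g) \<alpha>) - \<alpha>\<^sup>2 / 2) / \<alpha>"
        using eventually_gt_at_top[of K]
      proof eventually_elim
        case (elim \<alpha>)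
        have "K > 0" using \<delta>0 by (simp add: K_def)
        with elim have \<alpha>0: "\<alpha> > 0" by simp
        have "2 * real n + 1 \<le> \<alpha> * \<delta>" using elim \<delta>0 by (simp add: K_def pos_divide_less_eq)
        moreover have "(-1 + 1 / (8 * E)) * \<alpha> \<le> (- \<kappa> - \<delta>) * \<alpha>" using gain \<alpha>0 by (intro mult_right_mono) auto
        ultimately have "(-1 + 1 / (8 * E)) * \<alpha> \<le> L \<alpha> - \<alpha>\<^sup>2 / 2" by (simp add: L_def algebra_simps)
        then show ?case using \<alpha>0 by (auto simp: P_def pos_le_divide_eq)
      qed
    qed
    then have "Limsup at_top (\<lambda>\<alpha>. ereal ((real (lattice_count (f g) \<alpha>) - \<alpha>\<^sup>2 / 2) / \<alpha>)) > ereal (-1)"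
      by (rule Limsup_gt_if_frequently) (use E in simp)
    then show ?thesis using fg by (simp add: Lambda_set_def one_ereal_def)
  qed
  moreover have "f g \<noteq> real p / real q" if "small p q" for p q
  proof
    assume eq: "f g = real p / real q"
    obtain \<alpha> where "P g \<alpha>" using ex by blast
    then have "L \<alpha> \<le> real (lattice_count (f g) \<alpha>)" "real (lattice_count (real p / real q) \<alpha>) < L \<alpha>"
      using that by (simp_all add: P_def)
    then show False by (simp add: eq)
  qed
  ultimately show ?thesis unfolding small_def by blast
qed

theorem theorem2: "infinite (Lambda_set \<inter> S_set)"
proof
  assume fin: "finite (Lambda_set \<inter> S_set)"
  have "\<exists>p q :: nat. 0 < p \<and> 0 < q \<and> coprime p q \<and> \<gamma> = real p / real q" if "\<gamma> \<in> Lambda_set" for \<gamma>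
  proof -
    from that have \<gamma>: "\<gamma> \<in> \<rat>" "\<gamma> > 0" by (auto simp: Lambda_set_def)
    then obtain p q :: nat where "q \<noteq> 0" "\<bar>\<gamma>\<bar> = real p / real q" "coprime p q"
      by (elim Rats_abs_nat_div_natE)
    with \<gamma> show ?thesis by (intro exI[of _ p] exI[of _ q]) (auto intro: Nat.gr0I)
  qed
  then obtain p q :: "real \<Rightarrow> nat" where pq: "\<And>\<gamma>. \<gamma> \<in> Lambda_set \<Longrightarrow>
      0 < p \<gamma> \<and> 0 < q \<gamma> \<and> coprime (p \<gamma>) (q \<gamma>) \<and> \<gamma> = real (p \<gamma>) / real (q \<gamma>)"
    by metis
  \<comment> \<open>Large enough that each of the finitely many slopes counts as small, so the new
    slope differs from all of them.\<close>
  define n where "n = 1 + (\<Sum>\<gamma>\<in>Lambda_set \<inter> S_set. 16 * (p \<gamma> * q \<gamma>))"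
  obtain \<gamma> where \<gamma>: "\<gamma> \<in> Lambda_set \<inter> S_set"
    and ne: "\<forall>p q. 0 < p \<longrightarrow> 0 < q \<longrightarrow> coprime p q \<longrightarrow> 16 * (p * q) \<le> n * (n + 1) \<longrightarrow> \<gamma> \<noteq> real p / real q"
    using exists_optimal_slope_avoiding_small[of n] by (auto simp: n_def)
  have "16 * (p \<gamma> * q \<gamma>) \<le> (\<Sum>\<gamma>\<in>Lambda_set \<inter> S_set. 16 * (p \<gamma> * q \<gamma>))"
    using fin \<gamma> by (intro member_le_sum) auto
  then have "16 * (p \<gamma> * q \<gamma>) \<le> n * (n + 1)" by (simp add: n_def)
  with ne pq \<gamma> show False by blast
qed

end
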